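(* Let $1\le\beta\le\alpha$ be integers, and let $f_{\alpha,\beta}(x)$ be the toric $f$-polynomial of (the face lattice of) the hook shape lattice path matroid polytope $P_{\alpha,\beta}$. Then $$f_{\alpha,\beta}(x)=\sum_{k=0}^{\beta-1}\mathbf{S}_k x^{k}+\mathbf{S}_{\beta-1}\sum_{k=\beta}^{\alpha-1}x^k+\sum_{k=\alpha}^{\alpha+\beta-1}\mathbf{S}_{\alpha+\beta-1-k}\,x^k,$$ where $\mathbf{S}_\ell:=\sum_{k=0}^{\ell}\binom{\alpha-1}{k}\binom{\beta-1}{k}$ for $0\le\ell\le\beta-1$.
   Context: The polytope $P_{\alpha,\beta}$: lattice paths in $\mathbb{Z}\times\mathbb{Z}$ use north steps $\mathsf{N}=(0,1)$ and east steps $\mathsf{E}=(1,0)$. Let $\pi_1=\mathsf{N}\mathsf{E}^{\alpha-1}\mathsf{N}^{\beta-1}\mathsf{E}$ and $\pi_2=\mathsf{E}^{\alpha}\mathsf{N}^{\beta}$, which enclose a hook shape. For each lattice path $\sigma=\sigma_1\cdots\sigma_{\alpha+\beta}$ from $(0,0)$ to $(\alpha,\beta)$ staying weakly between $\pi_1$ and $\pi_2$, let $B_\sigma=\{i:\sigma_i=\mathsf{N}\}$. Then $P_{\alpha,\beta}\subset\mathbb{R}^{\alpha+\beta}$ is the convex hull of the vectors $\sum_{i\in B_\sigma}\mathbf{e}_i$ over all such $\sigma$. Equivalently, $P_{\alpha,\beta}$ is the convex hull of $\mathbf{v}_{0,1}=\sum_{l=1}^{\beta}\mathbf{e}_{\alpha+l}$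 and of all $\mathbf{v}_{i,j}=\mathbf{v}_{0,1}+\mathbf{e}_i-\mathbf{e}_{\alpha+j}$ with $1\le i\le\alpha$, $1\le j\le\beta$. Toric polynomials: let $\mathcal{P}$ be the face lattice of a convex polytope (including the empty face $\emptyset$ and the polytope itself), graded with rank function $\rho$, $\rho(\emptyset)=0$; a polytope of dimension $n$ has face lattice of rank $n+1$. Let $\widetilde{\mathcal{P}}$ be the set of all intervals $[\emptyset,y]$, $y\in\mathcal{P}$, with $\rho([\emptyset,y])=\rho(y)$. The toric $f$-polynomial $f(\mathcal{P},x)$ and toric $g$-polynomial $g(\mathcal{P},x)$ are defined inductively: (i) $f(\mathbf{1},x)=g(\mathbf{1},x)=1$ for the one-element poset $\mathbf{1}$; (ii) if $\mathcal{P}$ has rank $n+1>0$, then $$f(\mathcal{P},x)=\sum_{\mathcal{Q}\in\widetilde{\mathcal{P}},\ \mathcal{Q}\ne\mathcal{P}}g(\mathcal{Q},x)(x-1)^{n-\rho(\mathcal{Q})},$$ which has degree $n$; (iii) writing $f(\mathcal{P},x)=h_0+h_1x+\cdots+h_nx^n$, $g(\mathcal{P},x)=h_0+(h_1-h_0)x+\cdots+(h_m-h_{m-1})x^m$ with $m=\lfloor n/2\rfloor$. The toric polynomials of a polytope are those of its face lattice. Empty sums are $0$. *)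

theory Defs
  imports "HOL-Analysis.Analysis" "HOL-Computational_Algebra.Polynomial"
begin

datatype step = North | East

(* Upper and lower boundary of the hook shape, for a, b >= 1. *)
definition upper_path :: "nat \<Rightarrow> nat \<Rightarrow> step list" where
  "upper_path a b = [North] @ replicate (a - 1) East @ replicate (b - 1) North @ [East]"

definition lower_path :: "nat \<Rightarrow> nat \<Rightarrow> step list" where
  "lower_path a b = replicate a East @ replicate b North"

(* Ordinate of a path after its first k steps.  All paths from the origin are on the
   antidiagonal x + y = k at that time, so comparing ordinates compares the paths. *)
definition height :: "step list \<Rightarrow> nat \<Rightarrow> nat" where
  "height s k = count_list (take k s) North"

definition hook_paths :: "nat \<Rightarrow> nat \<Rightarrow> step list set" where
  "hook_paths a b =
    {s. count_list s East = a \<and> count_list s North = b \<and>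
        (\<forall>k\<le>a + b. height (lower_path a b) k \<le> height s k \<and>
                  height s k \<le> height (upper_path a b) k)}"

(* Positions are counted from 1, list indices from 0. *)
definition north_positions :: "step list \<Rightarrow> nat set" where
  "north_positions s = {i. 1 \<le> i \<and> i \<le> length s \<and> s ! (i - 1) = North}"

(* The function e enumerates the standard basis: e 1, ..., e (a + b). *)
definition hook_polytope :: "(nat \<Rightarrow> 'a::real_vector) \<Rightarrow> nat \<Rightarrow> nat \<Rightarrow> 'a set" where
  "hook_polytope e a b =
    convex hull ((\<lambda>s. \<Sum>i\<in>north_positions s. e i) ` hook_paths a b)"

(* Ordered by inclusion.  Both the empty face and the polytope itself are faces in the
   sense of face_of. *)
definition face_lattice :: "'a::real_vector set \<Rightarrow> 'a set set" where
  "face_lattice S = {F. F face_of S}"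

(* A finite poset is given by its carrier, with the order of the type.  Its rank is the
   length of a longest chain; for a graded poset all maximal chains have this length. *)
definition poset_rank :: "'b::order set \<Rightarrow> nat" where
  "poset_rank P =
    Max {card C - 1 | C. C \<subseteq> P \<and> C \<noteq> {} \<and> Complete_Partial_Order.chain (\<le>) C}"

(* The intervals from the least element of P to y, for y in P. *)
definition lower_intervals :: "'b::order set \<Rightarrow> 'b set set" where
  "lower_intervals P = {{z \<in> P. z \<le> y} | y. y \<in> P}"

(* For f = h_0 + h_1 x + ... + h_n x^n this is
   h_0 + (h_1 - h_0) x + ... + (h_m - h_(m-1)) x^m with m = n div 2. *)
definition g_truncation :: "nat \<Rightarrow> int poly \<Rightarrow> int poly" where
  "g_truncation n f =
    [:coeff f 0:] + (\<Sum>i=1..n div 2. monom (coeff f i - coeff f (i - 1)) i)"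

(* The value 0 on infinite carriers is a dummy. *)
function toric_f :: "'b::order set \<Rightarrow> int poly"
  and toric_g :: "'b::order set \<Rightarrow> int poly" where
  "toric_f P =
    (if infinite P then 0
     else if card P = 1 then 1
     else \<Sum>Q\<in>lower_intervals P - {P}.
            toric_g Q * [:-1, 1:] ^ ((poset_rank P - 1) - poset_rank Q))"
| "toric_g P =
    (if infinite P then 0
     else if card P = 1 then 1
     else g_truncation (poset_rank P - 1) (toric_f P))"
  by pat_completeness auto
termination
proof (relation "measures [case_sum card card, case_sum (\<lambda>_. 0) (\<lambda>_. 1)]", goal_cases)
  case (2 P Q)
  then have "Q \<subset> P" by (auto simp: lower_intervals_def)
  with 2 show ?case by (simp add: psubset_card_mono)
qed auto

(* Unguarded simp rules for a recursion through itself would loop. *)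
declare toric_f.simps [simp del] toric_g.simps [simp del]

definition S_coeff :: "nat \<Rightarrow> nat \<Rightarrow> nat \<Rightarrow> int" where
  "S_coeff a b l = (\<Sum>k=0..l. int ((a - 1) choose k) * int ((b - 1) choose k))"

end

theory Submission
  imports Defs "HOL-Library.Product_Order"
begin

text \<open>
  The vertices \<open>v_ij = v_01 + e_i - e_(a+j)\<close> span a product of two simplices of dimensions \<open>a - 1\<close> and
  \<open>b - 1\<close>, and the hook polytope is the pyramid over it with apex \<open>v_01\<close>. Hence its face lattice is the
  face lattice \<open>L\<close> of the product times the two-element chain, the chain recording whether the
  apex belongs to the face.

  Every face of a pyramid is a face of the base or the cone over one, and inductively the cone has
  the same \<open>g\<close>-polynomial as its base. Pairing the two gives \<open>f(pyr L) = g(L) + x f(L)\<close>, and comparing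
  consecutive coefficients gives \<open>g(pyr L) = g(L)\<close>.

  The proper nonempty faces of the product are products of smaller simplices, so induction shows that
  \<open>g(L)\<close> has the coefficients \<open>(a - 1 choose k) (b - 1 choose k)\<close>. The recursion for \<open>f\<close>, multiplied by
  \<open>x - 1\<close>, becomes a sum over pairs of nonempty subsets that factors for each power of \<open>x\<close> and is
  evaluated by Pascal's rule.
\<close>

section \<open>Toric polynomials under order isomorphism and pyramids\<close>

abbreviation down :: "'b::order set \<Rightarrow> 'b \<Rightarrow> 'b set" where
  "down P y \<equiv> {z \<in> P. z \<le> y}"

abbreviation is_top :: "'b::order set \<Rightarrow> 'b \<Rightarrow> bool" where
  "is_top P t \<equiv> t \<in> P \<and> (\<forall>z\<in>P. z \<le> t)"

section \<open>Ranks of finite posets by longest chains\<close>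

lemma finite_chain_lengths:
  assumes "finite P"
  shows "finite {card C - 1 | C. C \<subseteq> P \<and> C \<noteq> {} \<and> Complete_Partial_Order.chain (\<le>) C}"
  using finite_subset[of _ "(\<lambda>C. card C - 1) ` Pow P"] assms by (auto intro: finite_subset)

lemma poset_rank_ge:
  fixes P :: "'b::order set"
  assumes "finite P" "C \<subseteq> P" "Complete_Partial_Order.chain (\<le>) C"
  shows "card C \<le> Suc (poset_rank P)"
proof (cases "C = {}")
  case False
  then have "card C - 1 \<le> poset_rank P"
    unfolding poset_rank_def using assms by (intro Max_ge finite_chain_lengths) auto
  then show ?thesis by simp
qed simp

lemma poset_rank_attained:
  fixes P :: "'b::order set"
  assumes "finite P" "P \<noteq> {}"
  obtains C where "C \<subseteq> P" "C \<noteq> {}" "Complete_Partial_Order.chain (\<le>) C" "card C = Suc (poset_rank P)"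
proof -
  let ?S = "{card C - 1 | C. C \<subseteq> P \<and> C \<noteq> {} \<and> Complete_Partial_Order.chain (\<le>) C}"
  obtain p where "p \<in> P" using assms by blast
  then have "card {p} - 1 \<in> ?S" by (intro CollectI exI[of _ "{p}"]) (auto simp: chain_def)
  then have "poset_rank P \<in> ?S"
    unfolding poset_rank_def using assms by (intro Max_in finite_chain_lengths) auto
  then obtain C where C: "C \<subseteq> P" "C \<noteq> {}" "Complete_Partial_Order.chain (\<le>) C"
    "poset_rank P = card C - 1" by auto
  moreover have "card C > 0"
    using C assms by (simp add: card_gt_0_iff finite_subset)
  ultimately show ?thesis using that by auto
qed

lemma poset_rank_le:
  fixes P :: "'b::order set"
  assumes "finite P" "P \<noteq> {}"
    and "\<And>C. C \<subseteq> P \<Longrightarrow> Complete_Partial_Order.chain (\<le>) C \<Longrightarrow> card C \<le> Suc n"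
  shows "poset_rank P \<le> n"
  using poset_rank_attained[OF assms(1,2)] assms(3) by (metis Suc_le_mono)

lemma poset_rank_singleton: "poset_rank {p} = 0"
proof -
  have "card C \<le> Suc 0" if "C \<subseteq> {p}" for C
    using card_mono[OF _ that] by simp
  then show ?thesis using poset_rank_le[of "{p}" 0] by simp
qed

text \<open>The element \<open>t\<close> lies above all of \<open>Q\<close> and outside it, so it
  lengthens a longest chain of \<open>Q\<close> by one.\<close>

lemma poset_rank_less:
  fixes P :: "'b::order set"
  assumes "finite P" "is_top P t" "Q \<subseteq> P" "t \<notin> Q" "Q \<noteq> {}"
  shows "poset_rank Q < poset_rank P"
proof -
  have fQ: "finite Q" using assms finite_subset by blast
  obtain C where C: "C \<subseteq> Q" "Complete_Partial_Order.chain (\<le>) C" "card C = Suc (poset_rank Q)"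
    using poset_rank_attained[OF fQ assms(5)] by metis
  have "Complete_Partial_Order.chain (\<le>) (insert t C)"
    using C assms unfolding chain_def by blast
  then have "card (insert t C) \<le> Suc (poset_rank P)"
    using C assms by (intro poset_rank_ge) auto
  moreover have "card (insert t C) = Suc (card C)"
    using C assms fQ by (intro card_insert_disjoint) (auto intro: finite_subset)
  ultimately show ?thesis using C by simp
qed

lemma lower_intervals_eq: "lower_intervals P = down P ` P"
  by (auto simp: lower_intervals_def)

text \<open>An interval determines its greatest element, so the sum can run over elements instead;
  the excluded interval \<open>P\<close> is the one belonging to \<open>t\<close>.\<close>

lemma sum_lower_intervals:
  assumes "is_top P t"
  shows "(\<Sum>Q\<in>lower_intervals P - {P}. h Q) = (\<Sum>y\<in>P - {t}. h (down P y))"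
proof -
  have inj: "inj_on (down P) P"
  proof (rule inj_onI)
    fix x y assume "x \<in> P" "y \<in> P" "down P x = down P y"
    then have "x \<in> down P y" "y \<in> down P x" by auto
    then show "x = y" by auto
  qed
  have eq: "lower_intervals P - {P} = down P ` (P - {t})"
  proof -
    have "down P t = P" using assms by auto
    moreover note lower_intervals_eq[of P]
    moreover have "down P ` (P - {t}) = down P ` P - down P ` {t}"
      using inj assms by (intro inj_on_image_set_diff) auto
    ultimately show ?thesis by simp
  qed
  show ?thesis unfolding eq
    by (rule sum.reindex_cong[OF inj_on_subset[OF inj]]) auto
qed

lemma toric_f_top:
  assumes "finite P" "card P \<noteq> 1" "is_top P t"
  shows "toric_f P = (\<Sum>y\<in>P - {t}. toric_g (down P y) * [:-1, 1:] ^ (poset_rank P - 1 - poset_rank (down P y)))"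
  using assms by (simp add: toric_f.simps sum_lower_intervals)

section \<open>Invariance under order isomorphism\<close>

lemma inj_on_order_embedding:
  fixes \<phi> :: "'b::order \<Rightarrow> 'c::order"
  assumes "\<And>x y. x \<in> P \<Longrightarrow> y \<in> P \<Longrightarrow> \<phi> x \<le> \<phi> y \<longleftrightarrow> x \<le> y"
  shows "inj_on \<phi> P"
proof (rule inj_onI)
  fix x y assume "x \<in> P" "y \<in> P" "\<phi> x = \<phi> y"
  then show "x = y" using assms[of x y] assms[of y x] by auto
qed

lemma poset_rank_iso:
  fixes \<phi> :: "'b::order \<Rightarrow> 'c::order"
  assumes "finite P" "P \<noteq> {}" "\<And>x y. x \<in> P \<Longrightarrow> y \<in> P \<Longrightarrow> \<phi> x \<le> \<phi> y \<longleftrightarrow> x \<le> y"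
  shows "poset_rank (\<phi> ` P) = poset_rank P"
proof (rule antisym)
  have inj: "inj_on \<phi> P"
    using assms(3) by (rule inj_on_order_embedding)
  show "poset_rank (\<phi> ` P) \<le> poset_rank P"
  proof (rule poset_rank_le)
    fix C assume C: "C \<subseteq> \<phi> ` P" "Complete_Partial_Order.chain (\<le>) C"
    then obtain D where D: "D \<subseteq> P" "C = \<phi> ` D" by (auto simp: subset_image_iff)
    have "Complete_Partial_Order.chain (\<le>) D"
    proof (rule chainI)
      fix x y assume "x \<in> D" "y \<in> D"
      then show "x \<le> y \<or> y \<le> x"
        using chainD[OF C(2), of "\<phi> x" "\<phi> y"] D assms(3)[of x y] assms(3)[of y x] by auto
    qed
    moreover have "card C = card D" using D inj by (metis card_image inj_on_subset)
    ultimately show "card C \<le> Suc (poset_rank P)"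
      using D assms poset_rank_ge by metis
  qed (use assms in auto)
  obtain C where C: "C \<subseteq> P" "Complete_Partial_Order.chain (\<le>) C" "card C = Suc (poset_rank P)"
    using poset_rank_attained[OF assms(1,2)] by metis
  have "Complete_Partial_Order.chain (\<le>) (\<phi> ` C)"
  proof (rule chainI)
    fix x' y' assume "x' \<in> \<phi> ` C" "y' \<in> \<phi> ` C"
    then obtain x y where xy: "x \<in> C" "y \<in> C" "x' = \<phi> x" "y' = \<phi> y" by blast
    then show "x' \<le> y' \<or> y' \<le> x'"
      using chainD[OF C(2), of x y] C(1) assms(3)[of x y] assms(3)[of y x] by auto
  qed
  then have "card (\<phi> ` C) \<le> Suc (poset_rank (\<phi> ` P))"
    using C assms by (intro poset_rank_ge) auto
  moreover have "card (\<phi> ` C) = card C" using C inj by (metis card_image inj_on_subset)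
  ultimately show "poset_rank P \<le> poset_rank (\<phi> ` P)" using C by simp
qed

text \<open>The recursion refers only to the order, and every lower interval other than
  \<open>P\<close> is a proper subset, which allows the induction. This later carries the
  polynomials from pairs of index sets to faces that are sets of points.\<close>

lemma toric_iso:
  fixes \<phi> :: "'b::order \<Rightarrow> 'c::order"
  assumes "finite P" "\<And>x y. x \<in> P \<Longrightarrow> y \<in> P \<Longrightarrow> \<phi> x \<le> \<phi> y \<longleftrightarrow> x \<le> y"
  shows "toric_f (\<phi> ` P) = toric_f P \<and> toric_g (\<phi> ` P) = toric_g P"
  using assms
proof (induction P rule: finite_psubset_induct)
  case (psubset P)
  have inj: "inj_on \<phi> P"
    using psubset.prems by (rule inj_on_order_embedding)
  then have card: "card (\<phi> ` P) = card P" by (rule card_image)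
  have rank: "poset_rank (\<phi> ` Q) = poset_rank Q" if "Q \<subseteq> P" for Q
  proof (cases "Q = {}")
    case True then show ?thesis
      by (simp add: poset_rank_def)
  next
    case False then show ?thesis
      using that psubset.hyps psubset.prems by (intro poset_rank_iso) (auto intro: finite_subset)
  qed
  have sub: "Q \<subset> P" if "Q \<in> lower_intervals P - {P}" for Q
    using that by (auto simp: lower_intervals_def)
  have "lower_intervals (\<phi> ` P) = (`) \<phi> ` lower_intervals P"
  proof -
    have "down (\<phi> ` P) (\<phi> y) = \<phi> ` down P y" if "y \<in> P" for y
      using psubset.prems that by auto
    then have "down (\<phi> ` P) ` \<phi> ` P = (`) \<phi> ` down P ` P"
      unfolding image_image by (intro image_cong) auto
    then show ?thesis by (simp only: lower_intervals_eq)
  qed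
  moreover have injI: "inj_on ((`) \<phi>) (Pow P)" using inj by (simp add: inj_on_image_Pow)
  moreover have "lower_intervals P \<subseteq> Pow P" by (auto simp: lower_intervals_def)
  \<comment> \<open>Taking images is injective on subsets of \<open>P\<close>, so it commutes with
    removing the whole poset.\<close>
  ultimately have li: "lower_intervals (\<phi> ` P) - {\<phi> ` P} = (`) \<phi> ` (lower_intervals P - {P})"
    using inj_on_image_set_diff[OF injI, of "lower_intervals P" "{P}"] by auto
  have "toric_f (\<phi> ` P) = toric_f P"
  proof -
    have "(\<Sum>Q\<in>lower_intervals (\<phi> ` P) - {\<phi> ` P}.
            toric_g Q * [:-1, 1:] ^ ((poset_rank (\<phi> ` P) - 1) - poset_rank Q))
      = (\<Sum>Q\<in>lower_intervals P - {P}.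
            toric_g Q * [:-1, 1:] ^ ((poset_rank P - 1) - poset_rank Q))"
      unfolding li
    proof (subst sum.reindex)
      show "inj_on ((`) \<phi>) (lower_intervals P - {P})"
        by (rule inj_on_subset[OF injI]) (use sub in auto)
      show "sum ((\<lambda>Q. toric_g Q * [:-1, 1:] ^ ((poset_rank (\<phi> ` P) - 1) - poset_rank Q)) \<circ> (`) \<phi>)
             (lower_intervals P - {P})
        = (\<Sum>Q\<in>lower_intervals P - {P}.
            toric_g Q * [:-1, 1:] ^ ((poset_rank P - 1) - poset_rank Q))"
      proof (rule sum.cong[OF refl])
        fix Q assume Q: "Q \<in> lower_intervals P - {P}"
        have "toric_g (\<phi> ` Q) = toric_g Q"
          using psubset.IH[OF sub[OF Q]] psubset.prems sub[OF Q] by blast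
        then show "((\<lambda>Q. toric_g Q * [:-1, 1:] ^ ((poset_rank (\<phi> ` P) - 1) - poset_rank Q)) \<circ> (`) \<phi>) Q
          = toric_g Q * [:-1, 1:] ^ ((poset_rank P - 1) - poset_rank Q)"
          using rank[of Q] rank[of P] sub[OF Q] by auto
      qed
    qed
    then show ?thesis using psubset.hyps card by (simp add: toric_f.simps[of P] toric_f.simps[of "\<phi> ` P"])
  qed
  moreover from this have "toric_g (\<phi> ` P) = toric_g P"
    using psubset.hyps card rank[of P] by (simp add: toric_g.simps[of P] toric_g.simps[of "\<phi> ` P"])
  ultimately show ?case by blast
qed

section \<open>Pyramids as products with the two-element chain\<close>

lemma poset_rank_pyramid:
  fixes P :: "'b::order set"
  assumes "finite P" "P \<noteq> {}"
  shows "poset_rank (P \<times> (UNIV :: bool set)) = Suc (poset_rank P)"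
proof (rule antisym)
  show "poset_rank (P \<times> (UNIV :: bool set)) \<le> Suc (poset_rank P)"
  proof (rule poset_rank_le)
    fix C :: "('b \<times> bool) set"
    assume C: "C \<subseteq> P \<times> UNIV" "Complete_Partial_Order.chain (\<le>) C"
    \<comment> \<open>The two levels of the chain. No element with \<open>True\<close> is below one
      with \<open>False\<close>, so \<open>C0\<close> lies weakly below \<open>C1\<close>: their
      union is a chain in \<open>P\<close>, and they share at most one element.\<close>
    define C0 C1 where "C0 = {y. (y, False) \<in> C}" and "C1 = {y. (y, True) \<in> C}"
    have sub: "C0 \<subseteq> P" "C1 \<subseteq> P" using C by (auto simp: C0_def C1_def)
    then have fin: "finite C0" "finite C1" using assms finite_subset by blast+
    have below: "y \<le> z" if "y \<in> C0" "z \<in> C1" for y z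
      using chainD[OF C(2), of "(y, False)" "(z, True)"] that by (auto simp: C0_def C1_def)
    have "Complete_Partial_Order.chain (\<le>) (C0 \<union> C1)"
    proof (rule chainI)
      have "y \<le> z \<or> z \<le> y" if "y \<in> C0" "z \<in> C0 \<or> z \<in> C1" for y z
        using chainD[OF C(2), of "(y, False)" "(z, False)"] below that by (auto simp: C0_def)
      moreover have "y \<le> z \<or> z \<le> y" if "y \<in> C1" "z \<in> C1" for y z
        using chainD[OF C(2), of "(y, True)" "(z, True)"] that by (auto simp: C1_def)
      ultimately show "y \<le> z \<or> z \<le> y" if "y \<in> C0 \<union> C1" "z \<in> C0 \<union> C1" for y z
        using that by blast
    qed
    then have 1: "card (C0 \<union> C1) \<le> Suc (poset_rank P)"
      using sub assms by (intro poset_rank_ge) auto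
    have "y = z" if "y \<in> C0 \<inter> C1" "z \<in> C0 \<inter> C1" for y z
      using below[of y z] below[of z y] that by auto
    then have 2: "card (C0 \<inter> C1) \<le> 1"
      using fin by (simp add: card_le_Suc0_iff_eq)
    have "C = (\<lambda>y. (y, False)) ` C0 \<union> (\<lambda>y. (y, True)) ` C1"
    proof (rule set_eqI)
      fix p show "p \<in> C \<longleftrightarrow> p \<in> (\<lambda>y. (y, False)) ` C0 \<union> (\<lambda>y. (y, True)) ` C1"
        by (cases p; cases "snd p") (auto simp: C0_def C1_def)
    qed
    then have "card C \<le> card ((\<lambda>y. (y, False)) ` C0) + card ((\<lambda>y. (y, True)) ` C1)"
      using card_Un_le by simp
    also have "\<dots> \<le> card C0 + card C1"
      using fin by (intro add_mono card_image_le)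
    also have "\<dots> = card (C0 \<union> C1) + card (C0 \<inter> C1)"
      using fin card_Un_Int by blast
    finally show "card C \<le> Suc (Suc (poset_rank P))" using 1 2 by simp
  qed (use assms in auto)
  obtain C where C: "C \<subseteq> P" "C \<noteq> {}" "Complete_Partial_Order.chain (\<le>) C" "card C = Suc (poset_rank P)"
    using poset_rank_attained[OF assms] by metis
  have fC: "finite C" using C assms finite_subset by blast
  obtain m where m: "m \<in> C" "\<And>x. x \<in> C \<Longrightarrow> m \<le> x \<Longrightarrow> m = x"
    using finite_has_maximal[OF fC C(2)] by metis
  then have top: "x \<le> m" if "x \<in> C" for x
    using C(3) that unfolding chain_def by blast
  \<comment> \<open>At its maximum \<open>m\<close>, a longest chain of the base is extended by the
    step from \<open>False\<close> to \<open>True\<close>.\<close>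
  define D where "D = insert (m, True) (C \<times> {False})"
  have "Complete_Partial_Order.chain (\<le>) D"
    using C(3) top unfolding chain_def D_def by auto
  then have "card D \<le> Suc (poset_rank (P \<times> (UNIV :: bool set)))"
    using C m assms by (intro poset_rank_ge) (auto simp: D_def)
  moreover have "card D = Suc (card C)"
    unfolding D_def using fC by (simp add: card_cartesian_product)
  ultimately show "Suc (poset_rank P) \<le> poset_rank (P \<times> (UNIV :: bool set))" using C by simp
qed

lemma coeff_g_truncation:
  "coeff (g_truncation n f) i =
    (if i = 0 then coeff f 0 else if i \<le> n div 2 then coeff f i - coeff f (i - 1) else 0)"
proof -
  have "coeff (\<Sum>i=1..n div 2. monom (coeff f i - coeff f (i - 1)) i) j
    = (if 1 \<le> j \<and> j \<le> n div 2 then coeff f j - coeff f (j - 1) else 0)" for j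
    by (simp add: coeff_sum if_distrib sum.delta' cong: if_cong)
  then show ?thesis by (auto simp: g_truncation_def coeff_pCons split: nat.splits)
qed

text \<open>With \<open>g\<close> the truncation, the difference of consecutive coefficients is g_i
  - g_(i-1) + (f_(i-1) - f_(i-2)), and the bracket is g_(i-1). When \<open>n\<close> is odd one more
  index passes the new truncation bound; there g_i is 0 and the same cancellation gives 0.\<close>

lemma g_truncation_pyramid:
  "g_truncation (Suc n) (g_truncation n f + [:0, 1:] * f) = g_truncation n f"
proof (rule poly_eqI)
  fix i
  have *: "[:0, 1:] * f = pCons 0 f" by simp
  show "coeff (g_truncation (Suc n) (g_truncation n f + [:0, 1:] * f)) i = coeff (g_truncation n f) i"
    unfolding * by (cases i) (auto simp: coeff_g_truncation coeff_pCons split: nat.splits)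
qed

text \<open>The top varies in the induction because \<open>down P y\<close> has top
  \<open>y\<close>. A one-element \<open>P\<close> is excluded from the second claim: the pyramid
  then has \<open>toric_f\<close> equal to 1, while the formula would give 1 + x.\<close>

lemma toric_pyramid:
  fixes P :: "'b::order set"
  assumes "finite P" "is_top P t"
  shows "toric_g (P \<times> (UNIV :: bool set)) = toric_g P \<and>
    (card P \<noteq> 1 \<longrightarrow> toric_f (P \<times> (UNIV :: bool set)) = toric_g P + [:0, 1:] * toric_f P)"
  using assms
proof (induction P arbitrary: t rule: finite_psubset_induct)
  case (psubset P)
  let ?PB = "P \<times> (UNIV :: bool set)" and ?y = "[:-1, 1:] :: int poly"
  have t: "t \<in> P" "\<And>z. z \<in> P \<Longrightarrow> z \<le> t" using psubset.prems by auto
  have ne: "P \<noteq> {}" using t by auto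
  have rankPB: "poset_rank ?PB = Suc (poset_rank P)"
    using poset_rank_pyramid psubset.hyps ne by blast
  have topPB: "is_top ?PB (t, True)" using t by auto
  have finPB: "finite ?PB" using psubset.hyps by simp
  have cardPB: "card ?PB = 2 * card P" by (simp add: card_cartesian_product)
  then have c1: "card ?PB \<noteq> 1" by presburger
  have dF: "down ?PB (y, False) = (\<lambda>z. (z, False)) ` down P y" for y by auto
  have dT: "down ?PB (y, True) = down P y \<times> UNIV" for y by auto
  have gF: "toric_g (down ?PB (y, False)) = toric_g (down P y)"
    and rF: "poset_rank (down ?PB (y, False)) = poset_rank (down P y)" if "y \<in> P" for y
    unfolding dF using that psubset.hyps
    by (auto intro!: toric_iso[THEN conjunct2] poset_rank_iso)
  \<comment> \<open>The top is left out here: for it the interval is \<open>?PB\<close> itself,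
    whose polynomial is still to be found.\<close>
  have gT: "toric_g (down ?PB (y, True)) = toric_g (down P y)"
    and rT: "poset_rank (down ?PB (y, True)) = Suc (poset_rank (down P y))" if "y \<in> P - {t}" for y
  proof -
    have "t \<notin> down P y" using that t by (auto intro: antisym)
    then have "down P y \<subset> P" using t by auto
    from psubset.IH[OF this, of y] show "toric_g (down ?PB (y, True)) = toric_g (down P y)"
      unfolding dT using that by auto
    show "poset_rank (down ?PB (y, True)) = Suc (poset_rank (down P y))"
      unfolding dT using that psubset.hyps by (intro poset_rank_pyramid) auto
  qed
  have split: "?PB - {(t, True)} = (\<lambda>y. (y, False)) ` P \<union> (\<lambda>y. (y, True)) ` (P - {t})"
    by (auto simp: image_iff)
  have f_sum: "toric_f ?PB = (\<Sum>y\<in>P. toric_g (down P y) * ?y ^ (poset_rank P - poset_rank (down P y)))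
      + (\<Sum>y\<in>P - {t}. toric_g (down P y) * ?y ^ (poset_rank P - Suc (poset_rank (down P y))))"
  proof -
    have "toric_f ?PB = (\<Sum>p\<in>?PB - {(t, True)}. toric_g (down ?PB p) * ?y ^ (poset_rank P - poset_rank (down ?PB p)))"
      using toric_f_top[OF finPB c1 topPB] rankPB by simp
    also have "\<dots> = (\<Sum>p\<in>(\<lambda>y. (y, False)) ` P. toric_g (down ?PB p) * ?y ^ (poset_rank P - poset_rank (down ?PB p)))
      + (\<Sum>p\<in>(\<lambda>y. (y, True)) ` (P - {t}). toric_g (down ?PB p) * ?y ^ (poset_rank P - poset_rank (down ?PB p)))"
      unfolding split using psubset.hyps by (intro sum.union_disjoint) auto
    also have "(\<Sum>p\<in>(\<lambda>y. (y, False)) ` P. toric_g (down ?PB p) * ?y ^ (poset_rank P - poset_rank (down ?PB p)))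
      = (\<Sum>y\<in>P. toric_g (down P y) * ?y ^ (poset_rank P - poset_rank (down P y)))"
      by (rule sum.reindex_cong[where l = "\<lambda>y. (y, False)"]) (auto simp only: inj_on_def gF rF prod.inject)
    also have "(\<Sum>p\<in>(\<lambda>y. (y, True)) ` (P - {t}). toric_g (down ?PB p) * ?y ^ (poset_rank P - poset_rank (down ?PB p)))
      = (\<Sum>y\<in>P - {t}. toric_g (down P y) * ?y ^ (poset_rank P - Suc (poset_rank (down P y))))"
      by (rule sum.reindex_cong[where l = "\<lambda>y. (y, True)"]) (auto simp only: inj_on_def gT rT prod.inject)
    finally show ?thesis .
  qed
  have downt: "down P t = P" using t by auto
  show ?case
  proof (cases "card P = 1")
    case True
    then have P: "P = {t}" using t by (metis card_1_singletonE singletonD)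
    have "toric_f ?PB = 1" unfolding f_sum using P downt by (simp add: toric_g.simps)
    moreover have "g_truncation 0 1 = 1" by (simp add: g_truncation_def one_pCons)
    moreover have "poset_rank P = 0" using P poset_rank_singleton by simp
    ultimately show ?thesis
      using True finPB c1 rankPB psubset.hyps by (simp add: toric_g.simps[of ?PB] toric_g.simps[of P])
  next
    case False
    have rless: "poset_rank (down P y) < poset_rank P" if "y \<in> P - {t}" for y
    proof (rule poset_rank_less)
      show "is_top P t" using t by blast
      show "t \<notin> down P y" using that t by (auto intro: antisym)
    qed (use that psubset.hyps in auto)
    have "P \<noteq> {t}" using False by auto
    then obtain y where "y \<in> P - {t}" using t by auto
    then have rpos: "poset_rank P > 0" using rless by fastforce
    \<comment> \<open>In the base sum the term of \<open>t\<close> has exponent 0 and contributes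
      \<open>toric_g P\<close>. Every other element now occurs in both sums, as a face of the base
      and as the cone over it.\<close>
    have "toric_f ?PB = toric_g P
       + (\<Sum>y\<in>P - {t}. toric_g (down P y) * ?y ^ (poset_rank P - poset_rank (down P y)))
       + (\<Sum>y\<in>P - {t}. toric_g (down P y) * ?y ^ (poset_rank P - Suc (poset_rank (down P y))))"
      unfolding f_sum using t psubset.hyps by (simp add: sum.remove[of P t] downt)
    also have "\<dots> = toric_g P + [:0, 1:] * (\<Sum>y\<in>P - {t}. toric_g (down P y) * ?y ^ (poset_rank P - 1 - poset_rank (down P y)))"
      unfolding add.assoc sum.distrib[symmetric] sum_distrib_left
    proof (rule arg_cong2[where f = plus, OF refl], rule sum.cong[OF refl])
      fix y assume "y \<in> P - {t}"
      \<comment> \<open>Writing the rank as a sum removes the truncated subtractions; a face and its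
        cone then contribute (x - 1)^(d + 1) + (x - 1)^d = x (x - 1)^d.\<close>
      then obtain d where d: "poset_rank P = Suc (poset_rank (down P y) + d)"
        using rless less_imp_Suc_add by metis
      have "?y ^ Suc d + ?y ^ d = [:0, 1:] * ?y ^ d"
      proof -
        have "?y ^ Suc d + ?y ^ d = (?y + 1) * ?y ^ d" by (simp only: power_Suc distrib_right mult_1_left)
        also have "?y + 1 = [:0, 1:]" by (simp add: one_pCons)
        finally show ?thesis .
      qed
      moreover have e: "poset_rank P - poset_rank (down P y) = Suc d"
        "poset_rank P - Suc (poset_rank (down P y)) = d"
        "poset_rank P - 1 - poset_rank (down P y) = d" using d by simp_all
      ultimately show "toric_g (down P y) * ?y ^ (poset_rank P - poset_rank (down P y)) +
          toric_g (down P y) * ?y ^ (poset_rank P - Suc (poset_rank (down P y)))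
        = [:0, 1:] * (toric_g (down P y) * ?y ^ (poset_rank P - 1 - poset_rank (down P y)))"
        unfolding e by (simp only: distrib_left[symmetric] mult.left_commute[of _ "toric_g (down P y)"])
    qed
    also have "\<dots> = toric_g P + [:0, 1:] * toric_f P"
      using toric_f_top[OF psubset.hyps False psubset.prems] by simp
    finally have f: "toric_f ?PB = toric_g P + [:0, 1:] * toric_f P" .
    have g: "toric_g P = g_truncation (poset_rank P - 1) (toric_f P)"
      using False psubset.hyps by (simp add: toric_g.simps)
    have "toric_g ?PB = g_truncation (Suc (poset_rank P - 1)) (toric_f ?PB)"
      using c1 finPB rankPB rpos by (simp add: toric_g.simps[of ?PB])
    also have "\<dots> = toric_g P" unfolding f g by (rule g_truncation_pyramid)
    finally show ?thesis using f by blast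
  qed
qed

section \<open>A binomial identity\<close>

lemma sum_Pow_insert:
  fixes h :: "'i set \<Rightarrow> 'r::comm_monoid_add"
  assumes "finite A" "a \<notin> A"
  shows "(\<Sum>I\<in>Pow (insert a A). h I) = (\<Sum>I\<in>Pow A. h I) + (\<Sum>I\<in>Pow A. h (insert a I))"
proof -
  have "inj_on (insert a) (Pow A)" using assms by (intro inj_onI) auto
  then show ?thesis
    unfolding Pow_insert using assms by (subst sum.union_disjoint) (auto simp: sum.reindex)
qed

text \<open>Choosing a \<open>k\<close>-subset of \<open>I\<close> first leaves each other element
  of \<open>A\<close> either in \<open>I\<close>, with weight 1, or outside it, with weight
  \<open>y\<close>. The induction splits by whether \<open>I\<close> contains the new element and
  uses Pascal's rule.\<close>

lemma sum_Pow_choose: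
  fixes y :: "'r::comm_ring_1"
  assumes "finite A"
  shows "(\<Sum>I\<in>Pow A. of_nat (card I choose k) * y ^ (card A - card I))
    = of_nat (card A choose k) * (y + 1) ^ (card A - k)"
  using assms
proof (induction A arbitrary: k rule: finite_induct)
  case empty
  then show ?case by (cases k) auto
next
  case (insert a A)
  let ?B = "\<lambda>k. \<Sum>I\<in>Pow A. of_nat (card I choose k) * y ^ (card A - card I)"
  have ca: "card (insert a I) = Suc (card I)" "card I \<le> card A" if "I \<in> Pow A" for I
    using that insert by (auto simp: card_insert_if finite_subset card_mono)
  have "(\<Sum>I\<in>Pow (insert a A). of_nat (card I choose k) * y ^ (card (insert a A) - card I))
    = (\<Sum>I\<in>Pow A. y * (of_nat (card I choose k) * y ^ (card A - card I)))
      + (\<Sum>I\<in>Pow A. of_nat (Suc (card I) choose k) * y ^ (card A - card I))"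
    unfolding sum_Pow_insert[OF insert.hyps]
    by (intro arg_cong2[where f = plus] sum.cong refl) (use insert.hyps in \<open>auto simp: ca Suc_diff_le\<close>)
  also have "\<dots> = (y + 1) * ?B k + (case k of 0 \<Rightarrow> 0 | Suc j \<Rightarrow> ?B j)"
    by (cases k) (simp_all add: sum_distrib_left algebra_simps sum.distrib)
  also have "\<dots> = of_nat (card (insert a A) choose k) * (y + 1) ^ (card (insert a A) - k)"
  proof (cases k)
    case (Suc j)
    show ?thesis
    proof (cases "k \<le> card A")
      case True
      then have "Suc (card A) - k = Suc (card A - k)" "card A - j = Suc (card A - k)"
        using Suc by auto
      then show ?thesis using insert Suc by (simp add: algebra_simps)
    next
      case False
      then show ?thesis using insert Suc by (simp add: binomial_eq_0)
    qed
  qed (use insert.IH[of 0] insert.hyps in simp)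
  finally show ?case .
qed

text \<open>The value of the sum over nonempty subsets in \<open>sum_nonempty_choose\<close>, as a recursion in the
  size of the ambient set, because the identities below are proved by induction on that size.\<close>
fun nonempty_sum :: "'r::comm_ring_1 \<Rightarrow> nat \<Rightarrow> nat \<Rightarrow> 'r" where
  "nonempty_sum y k 0 = 0"
| "nonempty_sum y k (Suc a) = y * nonempty_sum y k a + of_nat (a choose k) * (y + 1) ^ (a - k)"

text \<open>Sets that avoid the new element gain a factor \<open>y\<close>. For the others, card - 1
  is the size of an arbitrary subset of the old set, so that \<open>sum_Pow_choose\<close>
  applies.\<close>

lemma sum_nonempty_choose:
  fixes y :: "'r::comm_ring_1"
  assumes "finite A"
  shows "(\<Sum>I\<in>Pow A - {{}}. of_nat ((card I - 1) choose k) * y ^ (card A - card I)) = nonempty_sum y k (card A)"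
  using assms
proof (induction A rule: finite_induct)
  case (insert a A)
  have ca: "card (insert a I) = Suc (card I)" "card I \<le> card A" if "I \<in> Pow A" for I
    using that insert by (auto simp: card_insert_if finite_subset card_mono)
  have "Pow (insert a A) - {{}} = (Pow A - {{}}) \<union> insert a ` Pow A" by (auto simp: Pow_insert)
  moreover have "inj_on (insert a) (Pow A)" using insert by (intro inj_onI) auto
  ultimately have "(\<Sum>I\<in>Pow (insert a A) - {{}}. of_nat ((card I - 1) choose k) * y ^ (card (insert a A) - card I))
    = (\<Sum>I\<in>Pow A - {{}}. of_nat ((card I - 1) choose k) * y ^ (Suc (card A) - card I))
      + (\<Sum>I\<in>Pow A. of_nat ((card (insert a I) - 1) choose k) * y ^ (Suc (card A) - card (insert a I)))"
    using insert by (simp, subst sum.union_disjoint) (auto simp: sum.reindex)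
  also have "(\<Sum>I\<in>Pow A. of_nat ((card (insert a I) - 1) choose k) * y ^ (Suc (card A) - card (insert a I)))
    = (\<Sum>I\<in>Pow A. of_nat (card I choose k) * y ^ (card A - card I))"
    by (intro sum.cong refl) (simp add: ca)
  also have "(\<Sum>I\<in>Pow A - {{}}. of_nat ((card I - 1) choose k) * y ^ (Suc (card A) - card I))
    = (\<Sum>I\<in>Pow A - {{}}. y * (of_nat ((card I - 1) choose k) * y ^ (card A - card I)))"
    by (intro sum.cong refl) (auto simp: ca Suc_diff_le)
  finally show ?case
    using insert by (simp add: sum_Pow_choose sum_distrib_left[symmetric])
qed simp

text \<open>For \<open>N\<close> large this is x^b times the polynomial with coefficients (a choose
  k) (b choose k), taken at 1/x. The bound \<open>N\<close> is a separate parameter so that sums for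
  different \<open>a\<close> and \<open>b\<close> have the same range and combine termwise; the
  surplus terms vanish.\<close>

definition choose_sum :: "'r::comm_ring_1 \<Rightarrow> nat \<Rightarrow> nat \<Rightarrow> nat \<Rightarrow> 'r" where
  "choose_sum x N a b = (\<Sum>k\<le>N. of_nat (a choose k) * of_nat (b choose k) * x ^ (b - k))"

text \<open>Pascal's rule in \<open>a\<close> reduces the left side to terms (a choose k) (b + 1
  choose k + 1); Pascal's rule in \<open>b\<close> gives the same terms on the right. The bound on
  \<open>a\<close> removes the term of index \<open>Suc N\<close>.\<close>

lemma choose_sum_rec:
  fixes x :: "'r::comm_ring_1"
  assumes "a \<le> N"
  shows "choose_sum x (Suc N) (Suc a) (Suc b) - choose_sum x (Suc N) a (Suc b)
    = x * choose_sum x (Suc N) (Suc a) b - (x - 1) * choose_sum x (Suc N) a b"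
proof -
  let ?c = "\<lambda>n k. of_nat (n choose k) :: 'r"
  have diff: "choose_sum x (Suc N) (Suc a) d - choose_sum x (Suc N) a d
      = (\<Sum>k\<le>N. ?c a k * ?c d (Suc k) * x ^ (d - Suc k))" for d
    unfolding choose_sum_def sum_subtractf[symmetric] sum.atMost_Suc_shift
    by (simp add: algebra_simps sum.distrib)
  have V: "choose_sum x (Suc N) a b = (\<Sum>k\<le>N. ?c a k * ?c b k * x ^ (b - k))"
    unfolding choose_sum_def using assms by (simp add: binomial_eq_0)
  have "x * choose_sum x (Suc N) (Suc a) b - (x - 1) * choose_sum x (Suc N) a b
    = x * (choose_sum x (Suc N) (Suc a) b - choose_sum x (Suc N) a b) + choose_sum x (Suc N) a b"
    by (simp add: algebra_simps)
  also have "\<dots> = (\<Sum>k\<le>N. ?c a k * ?c (Suc b) (Suc k) * x ^ (Suc b - Suc k))"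
    unfolding diff unfolding V sum_distrib_left sum.distrib[symmetric]
  proof (rule sum.cong[OF refl])
    fix k
    show "x * (?c a k * ?c b (Suc k) * x ^ (b - Suc k)) + ?c a k * ?c b k * x ^ (b - k)
      = ?c a k * ?c (Suc b) (Suc k) * x ^ (Suc b - Suc k)"
    \<comment> \<open>For k >= b the exponent \<open>b - Suc k\<close> is truncated, but its
      binomial coefficient is 0.\<close>
    proof (cases "Suc k \<le> b")
      case True
      then have "b - k = Suc (b - Suc k)" by simp
      then show ?thesis by (simp add: algebra_simps)
    next
      case False
      then show ?thesis by (simp add: binomial_eq_0 algebra_simps)
    qed
  qed
  finally show ?thesis unfolding diff ..
qed

text \<open>This is the inhomogeneous part in the induction of \<open>sum_nonempty_sum_prod\<close>.
  Unfolding \<open>nonempty_sum\<close> once adds a \<open>choose_sum\<close>, because (x - 1) + 1 =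
  x, and \<open>choose_sum_rec\<close> absorbs it.\<close>

lemma sum_choose_nonempty_sum:
  fixes x :: "'r::comm_ring_1"
  assumes "a \<le> N"
  shows "(\<Sum>k\<le>Suc N. of_nat (Suc a choose k) * nonempty_sum (x - 1) k (Suc b))
    = x * choose_sum x (Suc N) (Suc a) b - (x - 1) * choose_sum x (Suc N) a b"
proof (induction b)
  case 0
  have "choose_sum x (Suc N) c 0 = 1" for c
    unfolding choose_sum_def sum.atMost_Suc_shift by simp
  moreover have "(\<Sum>k\<le>Suc N. of_nat (Suc a choose k) * nonempty_sum (x - 1) k (Suc 0)) = (1::'r)"
    unfolding sum.atMost_Suc_shift by simp
  ultimately show ?case by simp
next
  case (Suc b)
  have "(\<Sum>k\<le>Suc N. of_nat (Suc a choose k) * nonempty_sum (x - 1) k (Suc (Suc b)))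
    = (x - 1) * (\<Sum>k\<le>Suc N. of_nat (Suc a choose k) * nonempty_sum (x - 1) k (Suc b)) + choose_sum x (Suc N) (Suc a) (Suc b)"
    unfolding choose_sum_def sum_distrib_left sum.distrib[symmetric]
    by (intro sum.cong refl) (simp only: nonempty_sum.simps(2)[of _ _ "Suc b"] algebra_simps, simp add: algebra_simps)
  also have "\<dots> = (x - 1) * (choose_sum x (Suc N) (Suc a) (Suc b) - choose_sum x (Suc N) a (Suc b)) + choose_sum x (Suc N) (Suc a) (Suc b)"
    unfolding Suc choose_sum_rec[OF assms] ..
  also have "\<dots> = x * choose_sum x (Suc N) (Suc a) (Suc b) - (x - 1) * choose_sum x (Suc N) a (Suc b)"
    by (simp add: algebra_simps)
  finally show ?case .
qed

text \<open>The sum over \<open>k\<close> collects the nonempty faces of a product of simplices with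
  \<open>Suc a\<close> and \<open>Suc b\<close> vertices; the power of x - 1 is the contribution of
  the empty face.\<close>

lemma sum_nonempty_sum_prod:
  fixes x :: "'r::comm_ring_1"
  assumes "a \<le> Suc N"
  shows "(\<Sum>k\<le>Suc N. x ^ k * nonempty_sum (x - 1) k (Suc a) * nonempty_sum (x - 1) k (Suc b)) + (x - 1) ^ (a + b + 1)
    = x ^ Suc a * choose_sum x (Suc N) a b"
  using assms
proof (induction a)
  case 0
  \<comment> \<open>In the base case only \<open>k = 0\<close> survives, and its closed form cancels
    the power of x - 1.\<close>
  have A0: "nonempty_sum (x - 1) 0 n = x ^ n - (x - 1) ^ n" for n
  proof (induction n)
    case (Suc n)
    show ?case unfolding nonempty_sum.simps Suc by (simp add: algebra_simps)
  qed simp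
  have "choose_sum x (Suc N) 0 b = x ^ b"
    unfolding choose_sum_def sum.atMost_Suc_shift by simp
  moreover have "(\<Sum>k\<le>Suc N. x ^ k * nonempty_sum (x - 1) k (Suc 0) * nonempty_sum (x - 1) k (Suc b)) = nonempty_sum (x - 1) 0 (Suc b)"
    unfolding sum.atMost_Suc_shift by simp
  ultimately show ?case unfolding A0 by simp
next
  case (Suc a)
  let ?T = "\<lambda>a. \<Sum>k\<le>Suc N. x ^ k * nonempty_sum (x - 1) k (Suc a) * nonempty_sum (x - 1) k (Suc b)"
  have "x ^ k * nonempty_sum (x - 1) k (Suc (Suc a)) * nonempty_sum (x - 1) k (Suc b)
     = (x - 1) * (x ^ k * nonempty_sum (x - 1) k (Suc a) * nonempty_sum (x - 1) k (Suc b))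
       + x ^ Suc a * (of_nat (Suc a choose k) * nonempty_sum (x - 1) k (Suc b))" for k
  \<comment> \<open>The factor x^k complements the power of x in the recursion to x^(a + 1), which
    no longer depends on \<open>k\<close>; for larger \<open>k\<close> the binomial coefficient is
    0.\<close>
  proof (cases "k \<le> Suc a")
    case True
    have x: "x ^ Suc a = x ^ k * x ^ (Suc a - k)"
      using True by (simp only: power_add[symmetric] le_add_diff_inverse)
    show ?thesis unfolding x nonempty_sum.simps(2)[of "x - 1" k "Suc a"] diff_add_cancel
      by (simp only: algebra_simps)
  next
    case False
    then show ?thesis unfolding nonempty_sum.simps(2)[of "x - 1" k "Suc a"]
      by (simp add: binomial_eq_0 algebra_simps del: nonempty_sum.simps)
  qed
  then have "?T (Suc a) = (x - 1) * ?T a + x ^ Suc a * (\<Sum>k\<le>Suc N. of_nat (Suc a choose k) * nonempty_sum (x - 1) k (Suc b))"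
    by (simp only: sum.distrib sum_distrib_left)
  also have "\<dots> = (x - 1) * ?T a + x ^ Suc a * (x * choose_sum x (Suc N) (Suc a) b - (x - 1) * choose_sum x (Suc N) a b)"
    using Suc.prems by (subst sum_choose_nonempty_sum) auto
  finally have T: "?T (Suc a) = (x - 1) * ?T a + x ^ Suc a * (x * choose_sum x (Suc N) (Suc a) b - (x - 1) * choose_sum x (Suc N) a b)" .
  have IH: "?T a = x ^ Suc a * choose_sum x (Suc N) a b - (x - 1) ^ (a + b + 1)"
    using Suc by (simp add: eq_diff_eq del: nonempty_sum.simps sum.atMost_Suc)
  show ?case unfolding T IH by (simp add: algebra_simps)
qed

section \<open>Products of two simplices\<close>

text \<open>The pair \<open>(I, J)\<close> stands for the product of the faces spanned by \<open>I\<close> and \<open>J\<close>; the empty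
  face is represented by \<open>({}, {})\<close> alone.\<close>
definition simplex_prod :: "'i set \<Rightarrow> 'j set \<Rightarrow> ('i set \<times> 'j set) set" where
  "simplex_prod A B = {(I, J). I \<subseteq> A \<and> J \<subseteq> B \<and> (I = {} \<longleftrightarrow> J = {})}"

lemma finite_simplex_prod: "finite A \<Longrightarrow> finite B \<Longrightarrow> finite (simplex_prod A B)"
  by (rule finite_subset[of _ "Pow A \<times> Pow B"]) (auto simp: simplex_prod_def)

lemma is_top_simplex_prod: "A \<noteq> {} \<Longrightarrow> B \<noteq> {} \<Longrightarrow> is_top (simplex_prod A B) (A, B)"
  by (auto simp: simplex_prod_def)

lemma down_simplex_prod:
  "(I, J) \<in> simplex_prod A B \<Longrightarrow> down (simplex_prod A B) (I, J) = simplex_prod I J"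
  by (auto simp: simplex_prod_def)

lemma simplex_prod_split:
  "simplex_prod A B = insert ({}, {}) ((Pow A - {{}}) \<times> (Pow B - {{}}))"
  by (auto simp: simplex_prod_def)

section \<open>The rank of the face lattice of a product of simplices\<close>

lemma poset_rank_le_strict_mono:
  fixes P :: "'b::order set" and r :: "'b \<Rightarrow> nat"
  assumes "finite P" "P \<noteq> {}" "\<And>x y. x \<in> P \<Longrightarrow> y \<in> P \<Longrightarrow> x < y \<Longrightarrow> r x < r y"
    and "\<And>x. x \<in> P \<Longrightarrow> r x \<le> n"
  shows "poset_rank P \<le> n"
proof (rule poset_rank_le[OF assms(1,2)])
  fix C assume C: "C \<subseteq> P" "Complete_Partial_Order.chain (\<le>) C"
  have "inj_on r C"
  proof (rule inj_onI, rule ccontr)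
    fix x y assume xy: "x \<in> C" "y \<in> C" "r x = r y" "x \<noteq> y"
    then have "x < y \<or> y < x" using chainD[OF C(2), of x y] by (auto simp: less_le)
    then show False using assms(3)[of x y] assms(3)[of y x] xy C(1) by auto
  qed
  moreover have "r ` C \<subseteq> {..n}" using assms(4) C by auto
  ultimately have "card C \<le> card {..n}" by (intro card_inj_on_le[of r]) auto
  then show "card C \<le> Suc n" by simp
qed

text \<open>The upper bound uses dimension plus one as a strictly increasing rank function, the
  lower bound removes one vertex of a factor at a time.\<close>

lemma poset_rank_simplex_prod:
  assumes "finite A" "finite B" "A \<noteq> {}" "B \<noteq> {}"
  shows "poset_rank (simplex_prod A B) = card A + card B - 1"
proof (rule antisym)
  show "poset_rank (simplex_prod A B) \<le> card A + card B - 1"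
  \<comment> \<open>Truncated subtraction gives the empty face the value 0, below the value at least
    1 of every nonempty face.\<close>
  proof (rule poset_rank_le_strict_mono[where r = "\<lambda>(I, J). card I + card J - 1"])
    fix p q assume pq: "p \<in> simplex_prod A B" "q \<in> simplex_prod A B" "p < q"
    obtain I J I' J' where [simp]: "p = (I, J)" "q = (I', J')" by (cases p, cases q)
    have sub: "I \<subseteq> I'" "J \<subseteq> J'" and ne: "I \<noteq> I' \<or> J \<noteq> J'"
      using pq(3) by (auto simp: less_le)
    have fin: "finite I'" "finite J'"
      using pq(2) assms(1,2) by (auto simp: simplex_prod_def intro: finite_subset)
    then have le: "card I \<le> card I'" "card J \<le> card J'" using sub by (auto intro: card_mono)
    have "card I < card I' \<or> card J < card J'"
      using ne sub fin by (metis psubset_card_mono psubsetI)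
    moreover have "card I' > 0 \<and> card J' > 0"
      using pq sub ne fin by (auto simp: simplex_prod_def card_gt_0_iff)
    ultimately show "(case p of (I, J) \<Rightarrow> card I + card J - 1) < (case q of (I, J) \<Rightarrow> card I + card J - 1)"
      using le pq(1) fin by auto
  next
    fix p assume "p \<in> simplex_prod A B"
    then show "(case p of (I, J) \<Rightarrow> card I + card J - 1) \<le> card A + card B - 1"
      using assms by (auto simp: simplex_prod_def intro!: diff_le_mono add_mono card_mono)
  qed (use assms in \<open>auto simp: finite_simplex_prod simplex_prod_split\<close>)
  show "card A + card B - 1 \<le> poset_rank (simplex_prod A B)"
    using assms
  proof (induction "card A + card B" arbitrary: A B rule: less_induct)
    case less
    have fin: "finite (simplex_prod A B)" using less.prems finite_simplex_prod by blast
    have step: "poset_rank (simplex_prod I J) < poset_rank (simplex_prod A B)"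
      if "(I, J) \<in> simplex_prod A B" "(I, J) \<noteq> (A, B)" for I J
    proof (rule poset_rank_less[OF fin is_top_simplex_prod])
      show "simplex_prod I J \<subseteq> simplex_prod A B" "(A, B) \<notin> simplex_prod I J"
        using that by (auto simp: simplex_prod_def)
    qed (use less.prems that in \<open>auto simp: simplex_prod_split\<close>)
    \<comment> \<open>A vertex may only be removed from a factor with at least two, since otherwise
      one component would become empty and the other not.\<close>
    consider "card A = 1" "card B = 1" | "card A \<noteq> 1" | "card B \<noteq> 1" by blast
    then show ?case
    proof cases
      case 1
      then show ?thesis using step[of "{}" "{}"] less.prems by (auto simp: simplex_prod_def)
    next
      case 2
      obtain x where x: "x \<in> A" using less.prems by blast
      have c: "card (A - {x}) = card A - 1" using x less.prems by simp
      have pos: "card A > 0" "card B > 0" using less.prems by (auto simp: card_gt_0_iff)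
      have ne: "A - {x} \<noteq> {}" using c 2 pos by (metis One_nat_def Suc_pred card.empty)
      have "card (A - {x}) + card B - 1 \<le> poset_rank (simplex_prod (A - {x}) B)"
        using less.hyps[of "A - {x}" B] less.prems ne c pos by simp
      moreover have "poset_rank (simplex_prod (A - {x}) B) < poset_rank (simplex_prod A B)"
        using step[of "A - {x}" B] ne less.prems x by (auto simp: simplex_prod_def)
      ultimately show ?thesis using c pos by simp
    next
      case 3
      obtain x where x: "x \<in> B" using less.prems by blast
      have c: "card (B - {x}) = card B - 1" using x less.prems by simp
      have pos: "card A > 0" "card B > 0" using less.prems by (auto simp: card_gt_0_iff)
      have ne: "B - {x} \<noteq> {}" using c 3 pos by (metis One_nat_def Suc_pred card.empty)
      have "card A + card (B - {x}) - 1 \<le> poset_rank (simplex_prod A (B - {x}))"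
        using less.hyps[of A "B - {x}"] less.prems ne c pos by simp
      moreover have "poset_rank (simplex_prod A (B - {x})) < poset_rank (simplex_prod A B)"
        using step[of A "B - {x}"] ne less.prems x by (auto simp: simplex_prod_def)
      ultimately show ?thesis using c pos by simp
    qed
  qed
qed

section \<open>The candidate polynomials for a product of simplices\<close>

definition hook_coeff :: "nat \<Rightarrow> nat \<Rightarrow> nat \<Rightarrow> int" where
  "hook_coeff a b k = int ((a - 1) choose k) * int ((b - 1) choose k)"

text \<open>If k <= a - 1 and k <= b - 1, then 2 k <= a + b - 2. So nothing is lost when
  \<open>g\<close> is cut off at half the degree.\<close>

lemma hook_coeff_eq_0: "a + b - 1 \<le> 2 * k \<Longrightarrow> 1 \<le> a \<Longrightarrow> 1 \<le> b \<Longrightarrow> hook_coeff a b k = 0"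
  unfolding hook_coeff_def by (cases "a \<le> k") (auto simp: binomial_eq_0)

lemma S_coeff_0: "S_coeff a b 0 = 1"
  by (simp add: S_coeff_def)

lemma S_coeff_Suc: "S_coeff a b (Suc l) = S_coeff a b l + hook_coeff a b (Suc l)"
  by (simp add: S_coeff_def hook_coeff_def)

lemma S_coeff_const:
  assumes "b - 1 \<le> l"
  shows "S_coeff a b l = S_coeff a b (b - 1)"
  using assms by (induction l rule: dec_induct) (auto simp: S_coeff_Suc hook_coeff_def binomial_eq_0)

definition simplex_prod_g :: "nat \<Rightarrow> nat \<Rightarrow> int poly" where
  "simplex_prod_g a b = (\<Sum>k\<le>a. monom (hook_coeff a b k) k)"

text \<open>The product has dimension \<open>a + b - 2\<close>. The \<open>min\<close> makes the
  coefficients palindromic; the lower half consists of partial sums of the coefficients of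
  \<open>simplex_prod_g\<close>.\<close>

definition simplex_prod_f :: "nat \<Rightarrow> nat \<Rightarrow> int poly" where
  "simplex_prod_f a b = (\<Sum>k\<le>a + b - 2. monom (S_coeff a b (min k (a + b - 2 - k))) k)"

lemma coeff_sum_monom:
  "finite K \<Longrightarrow> coeff (\<Sum>k\<in>K. monom (c k) k) i = (if i \<in> K then c i else 0)"
  by (simp add: coeff_sum if_distrib sum.delta' cong: if_cong)

lemma coeff_simplex_prod_g: "coeff (simplex_prod_g a b) k = hook_coeff a b k"
  unfolding simplex_prod_g_def by (auto simp: coeff_sum_monom hook_coeff_def binomial_eq_0)

lemma coeff_simplex_prod_f:
  "coeff (simplex_prod_f a b) k = (if k \<le> a + b - 2 then S_coeff a b (min k (a + b - 2 - k)) else 0)"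
  unfolding simplex_prod_f_def by (simp add: coeff_sum_monom)

lemma simplex_prod_g_sum:
  assumes "a \<le> N"
  shows "simplex_prod_g a b = (\<Sum>k\<le>N. of_nat ((a - 1) choose k) * of_nat ((b - 1) choose k) * [:0, 1:] ^ k)"
proof -
  have "of_nat ((a - 1) choose k) * of_nat ((b - 1) choose k) * [:0, 1:] ^ k = monom (hook_coeff a b k) k" for k
    by (simp add: hook_coeff_def monom_altdef of_nat_poly mult.commute)
  then show ?thesis
    using assms by (intro poly_eqI) (auto simp: coeff_simplex_prod_g coeff_sum_monom hook_coeff_def binomial_eq_0)
qed

lemma g_truncation_simplex_prod_f:
  assumes "1 \<le> a" "1 \<le> b"
  shows "g_truncation (a + b - 2) (simplex_prod_f a b) = simplex_prod_g a b"
proof (rule poly_eqI)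
  fix i
  show "coeff (g_truncation (a + b - 2) (simplex_prod_f a b)) i = coeff (simplex_prod_g a b) i"
  proof (cases i)
    case 0
    then show ?thesis
      by (simp add: coeff_g_truncation coeff_simplex_prod_f coeff_simplex_prod_g S_coeff_0 hook_coeff_def)
  next
    case (Suc j)
    show ?thesis
    proof (cases "i \<le> (a + b - 2) div 2")
      case True
      then have "min i (a + b - 2 - i) = Suc j" "min j (a + b - 2 - j) = j" "i \<le> a + b - 2"
        using Suc by auto
      then show ?thesis using Suc True
        by (simp add: coeff_g_truncation coeff_simplex_prod_f coeff_simplex_prod_g S_coeff_Suc)
    next
      case False
      then have "hook_coeff a b i = 0" using assms by (intro hook_coeff_eq_0) auto
      then show ?thesis using Suc False by (simp add: coeff_g_truncation coeff_simplex_prod_g)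
    qed
  qed
qed

text \<open>With \<open>f\<close> and \<open>g\<close> the two polynomials, this says \<open>(x - 1) f(x) = x^(a + b - 1) g(1/x) - g(x)\<close>.\<close>
lemma simplex_prod_f_eq:
  assumes "1 \<le> a" "1 \<le> b" "a \<le> N"
  shows "[:-1, 1:] * simplex_prod_f a b + simplex_prod_g a b = [:0, 1:] ^ a * choose_sum [:0, 1:] N (a - 1) (b - 1)"
proof (rule poly_eqI)
  fix i
  define m where "m = a + b - 2"
  have ab: "a + b = m + 2" using assms by (simp add: m_def)
  let ?c = "hook_coeff a b" and ?S = "S_coeff a b"
  have big: "?c k = 0" if "m < 2 * k" for k using that assms ab by (intro hook_coeff_eq_0) auto
  have bigN: "?c k = 0" if "a \<le> k \<or> b \<le> k" for k
    using that assms by (auto simp: hook_coeff_def binomial_eq_0)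
  have "coeff ([:0, 1:] ^ a * choose_sum [:0, 1:] N (a - 1) (b - 1)) i
    = coeff (\<Sum>k\<le>N. monom (?c k) (a + (b - 1 - k))) i"
  proof -
    have "[:0, 1:] ^ a * (of_nat ((a - 1) choose k) * of_nat ((b - 1) choose k) * [:0, 1:] ^ (b - 1 - k))
      = monom (?c k) (a + (b - 1 - k))" for k
      by (simp add: hook_coeff_def monom_altdef of_nat_poly power_add mult.commute)
    then show ?thesis unfolding choose_sum_def sum_distrib_left by simp
  qed
  \<comment> \<open>For k < b the exponent is m + 1 - k, so just one \<open>k\<close> reaches degree
    \<open>i\<close>; for k >= b the subtraction is truncated but the coefficient is 0.\<close>
  also have "\<dots> = (\<Sum>k\<le>N. if k = m + 1 - i \<and> i \<le> m + 1 then ?c k else 0)"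
    unfolding coeff_sum
  proof (rule sum.cong[OF refl])
    fix k
    show "coeff (monom (?c k) (a + (b - 1 - k))) i = (if k = m + 1 - i \<and> i \<le> m + 1 then ?c k else 0)"
      using ab assms bigN[of k] by (cases "k < b") auto
  qed
  also have "\<dots> = (if i \<le> m + 1 then ?c (m + 1 - i) else 0)"
  proof (cases "m + 1 - i \<le> N")
    case True
    then show ?thesis by (cases "i \<le> m + 1") (simp_all add: sum.delta')
  next
    case False
    then have "?c (m + 1 - i) = 0" using assms by (intro bigN) auto
    then show ?thesis using False by (auto intro!: sum.neutral)
  qed
  finally have rhs: "coeff ([:0, 1:] ^ a * choose_sum [:0, 1:] N (a - 1) (b - 1)) i = (if i \<le> m + 1 then ?c (m + 1 - i) else 0)" .
  have F: "coeff (simplex_prod_f a b) j = (if j \<le> m then ?S (min j (m - j)) else 0)" for j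
    by (simp add: coeff_simplex_prod_f m_def)
  have lhs: "coeff ([:-1, 1:] * simplex_prod_f a b + simplex_prod_g a b) i
    = (case i of 0 \<Rightarrow> 0 | Suc j \<Rightarrow> coeff (simplex_prod_f a b) j) - coeff (simplex_prod_f a b) i + ?c i"
    by (cases i) (simp_all add: coeff_simplex_prod_g)
  show "coeff ([:-1, 1:] * simplex_prod_f a b + simplex_prod_g a b) i
    = coeff ([:0, 1:] ^ a * choose_sum [:0, 1:] N (a - 1) (b - 1)) i"
    unfolding lhs rhs
  proof (cases i)
    case 0
    then show "(case i of 0 \<Rightarrow> 0 | Suc j \<Rightarrow> coeff (simplex_prod_f a b) j) - coeff (simplex_prod_f a b) i + ?c i
      = (if i \<le> m + 1 then ?c (m + 1 - i) else 0)"
      using big[of "m + 1"] by (simp add: F S_coeff_0) (simp add: hook_coeff_def)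
  next
    case (Suc j)
    \<comment> \<open>Below the centre of symmetry \<open>S_coeff\<close> increases by
      \<open>?c i\<close>, which cancels; above it the mirrored sums decrease by
      \<open>?c (m + 1 - i)\<close>; at 2 i = m + 1 two equal coefficients of \<open>f\<close> meet.
      The last two cases lie beyond the degree of \<open>f\<close>.\<close>
    consider "i \<le> m - i" "i \<le> m" | "i \<le> m" "m + 1 - i < i" | "i \<le> m" "m + 1 - i = i" | "i = m + 1" | "m + 1 < i"
      using Suc by linarith
    then show "(case i of 0 \<Rightarrow> 0 | Suc j \<Rightarrow> coeff (simplex_prod_f a b) j) - coeff (simplex_prod_f a b) i + ?c i
      = (if i \<le> m + 1 then ?c (m + 1 - i) else 0)"
    proof cases
      case 1
      then have "min i (m - i) = Suc j" "min j (m - j) = j" "?c (m + 1 - i) = 0"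
        using Suc by (auto intro!: big)
      then show ?thesis using 1 Suc by (simp add: F S_coeff_Suc)
    next
      case 2
      then have "min i (m - i) = m - i" "min j (m - j) = Suc (m - i)" "?c i = 0" "m + 1 - i = Suc (m - i)"
        using Suc by (auto intro!: big)
      then show ?thesis using 2 Suc by (simp add: F S_coeff_Suc)
    next
      case 3
      then have "min i (m - i) = j" "min j (m - j) = j" using Suc by auto
      then show ?thesis using 3 Suc by (simp add: F)
    next
      case 4
      then have "?c i = 0" by (intro big) auto
      then show ?thesis using 4 Suc by (simp add: F S_coeff_0) (simp add: hook_coeff_def)
    next
      case 5
      then have "?c i = 0" by (intro big) auto
      then show ?thesis using 5 Suc by (simp add: F)
    qed
  qed
qed

text \<open>Both polynomials are treated together because the recursion for \<open>toric_f\<close>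
  needs \<open>toric_g\<close> of smaller products. The factor x - 1 turns the exponent of a
  nonempty face into (card A - card I) + (card B - card J), which separates the two
  simplices.\<close>

lemma toric_simplex_prod:
  assumes "finite A" "finite B" "A \<noteq> {}" "B \<noteq> {}"
  shows "toric_f (simplex_prod A B) = simplex_prod_f (card A) (card B) \<and>
    toric_g (simplex_prod A B) = simplex_prod_g (card A) (card B)"
  using assms
proof (induction "card A + card B" arbitrary: A B rule: less_induct)
  case less
  let ?L = "simplex_prod A B" and ?a = "card A" and ?b = "card B"
  let ?x = "[:0, 1:] :: int poly" and ?y = "[:-1, 1:] :: int poly"
  let ?ne = "(Pow A - {{}}) \<times> (Pow B - {{}})"
  have fin: "finite ?L" using less.prems finite_simplex_prod by blast
  have pos: "1 \<le> ?a" "1 \<le> ?b" using less.prems by (simp_all add: Suc_le_eq card_gt_0_iff)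
  have xy: "?x - 1 = ?y" by (simp add: one_pCons)
  have rank: "poset_rank ?L = ?a + ?b - 1" using less.prems by (rule poset_rank_simplex_prod)
  have card: "card ?L \<noteq> 1"
  proof
    assume "card ?L = 1"
    then obtain p where "?L = {p}" by (auto simp: card_1_singleton_iff)
    moreover have "({}, {}) \<in> ?L" "(A, B) \<in> ?L" using less.prems by (auto simp: simplex_prod_def)
    ultimately show False using less.prems by auto
  qed
  have inner: "toric_g (down ?L p) * ?y ^ (poset_rank ?L - 1 - poset_rank (down ?L p)) * ?y
      = simplex_prod_g (card (fst p)) (card (snd p)) * (?y ^ (?a - card (fst p)) * ?y ^ (?b - card (snd p)))"
    if p: "p \<in> ?ne - {(A, B)}" for p
  proof -
    obtain I J where [simp]: "p = (I, J)" by (cases p)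
    have IJ: "I \<subseteq> A" "J \<subseteq> B" "I \<noteq> {}" "J \<noteq> {}" "(I, J) \<in> ?L" "(I, J) \<noteq> (A, B)"
      using p by (auto simp: simplex_prod_def)
    then have finIJ: "finite I" "finite J" using less.prems by (auto intro: finite_subset)
    have le: "card I \<le> ?a" "card J \<le> ?b" using IJ less.prems by (auto intro: card_mono)
    have "card I < ?a \<or> card J < ?b"
      using IJ less.prems by (metis psubset_card_mono psubsetI)
    then have lt: "card I + card J < ?a + ?b" using le by linarith
    have posIJ: "1 \<le> card I" "1 \<le> card J" using finIJ IJ by (simp_all add: Suc_le_eq card_gt_0_iff)
    have d: "down ?L p = simplex_prod I J" using IJ(5) by (simp only: \<open>p = (I, J)\<close> down_simplex_prod)
    have "toric_g (simplex_prod I J) = simplex_prod_g (card I) (card J)"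
      using less.hyps[OF lt] finIJ IJ by blast
    moreover have "poset_rank (simplex_prod I J) = card I + card J - 1"
      using finIJ IJ by (intro poset_rank_simplex_prod)
    \<comment> \<open>By \<open>lt\<close> the subtraction is not truncated, and the extra factor
      \<open>?y\<close> supplies the successor.\<close>
    moreover have "Suc (?a + ?b - 1 - 1 - (card I + card J - 1)) = (?a - card I) + (?b - card J)"
      using lt le posIJ pos by linarith
    ultimately show ?thesis unfolding d rank
      by (simp only: mult.assoc power_Suc2[symmetric] power_add fst_conv snd_conv \<open>p = (I, J)\<close>)
  qed
  have "?y * toric_f ?L = (\<Sum>p\<in>?L - {(A, B)}. toric_g (down ?L p) * ?y ^ (poset_rank ?L - 1 - poset_rank (down ?L p)) * ?y)"
    unfolding toric_f_top[OF fin card is_top_simplex_prod[OF less.prems(3,4)]]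
    by (simp only: sum_distrib_left sum_distrib_right mult.commute)
  \<comment> \<open>The empty face is split off: its rank is 0 and does not follow the formula card
    I + card J - 1 of the others.\<close>
  also have "?L - {(A, B)} = insert ({}, {}) (?ne - {(A, B)})"
    using less.prems by (auto simp: simplex_prod_split)
  also have "(\<Sum>p\<in>insert ({}, {}) (?ne - {(A, B)}). toric_g (down ?L p) * ?y ^ (poset_rank ?L - 1 - poset_rank (down ?L p)) * ?y)
    = toric_g (down ?L ({}, {})) * ?y ^ (poset_rank ?L - 1 - poset_rank (down ?L ({}, {}))) * ?y
      + (\<Sum>p\<in>?ne - {(A, B)}. toric_g (down ?L p) * ?y ^ (poset_rank ?L - 1 - poset_rank (down ?L p)) * ?y)"
    using less.prems by (intro sum.insert) auto
  also have "toric_g (down ?L ({}, {})) * ?y ^ (poset_rank ?L - 1 - poset_rank (down ?L ({}, {}))) * ?y = ?y ^ (?a + ?b - 1)"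
  proof -
    have "down ?L ({}, {}) = {({}, {})}"
      by (subst down_simplex_prod) (auto simp: simplex_prod_def)
    moreover have "Suc (?a + ?b - 1 - 1) = ?a + ?b - 1" using pos by linarith
    moreover have "toric_g {({}, {}) :: 'a set \<times> 'b set} = 1" by (simp add: toric_g.simps)
    ultimately show ?thesis
      by (simp only: rank poset_rank_singleton mult_1_left power_Suc2[symmetric] diff_zero)
  qed
  also have "(\<Sum>p\<in>?ne - {(A, B)}. toric_g (down ?L p) * ?y ^ (poset_rank ?L - 1 - poset_rank (down ?L p)) * ?y)
    = (\<Sum>p\<in>?ne - {(A, B)}. simplex_prod_g (card (fst p)) (card (snd p)) * (?y ^ (?a - card (fst p)) * ?y ^ (?b - card (snd p))))"
    by (intro sum.cong refl inner)
  \<comment> \<open>The added polynomial is exactly the missing term of \<open>(A, B)\<close>, so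
    the sum now runs over a full Cartesian product.\<close>
  finally have "?y * toric_f ?L + simplex_prod_g ?a ?b
    = ?y ^ (?a + ?b - 1) + (\<Sum>p\<in>?ne. simplex_prod_g (card (fst p)) (card (snd p)) * (?y ^ (?a - card (fst p)) * ?y ^ (?b - card (snd p))))"
    using less.prems by (subst sum.remove[of ?ne "(A, B)"]) auto
  \<comment> \<open>A range for \<open>k\<close> that is the same for all faces permits exchanging
    the sums; for each \<open>k\<close> the sum over pairs then factors.\<close>
  also have "(\<Sum>p\<in>?ne. simplex_prod_g (card (fst p)) (card (snd p)) * (?y ^ (?a - card (fst p)) * ?y ^ (?b - card (snd p))))
    = (\<Sum>p\<in>?ne. \<Sum>k\<le>Suc ?a. ?x ^ k * ((of_nat ((card (fst p) - 1) choose k) * ?y ^ (?a - card (fst p)))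
        * (of_nat ((card (snd p) - 1) choose k) * ?y ^ (?b - card (snd p)))))"
  proof (rule sum.cong[OF refl])
    fix p assume "p \<in> ?ne"
    then have "card (fst p) \<le> Suc ?a" using less.prems by (auto intro!: le_SucI card_mono)
    then show "simplex_prod_g (card (fst p)) (card (snd p)) * (?y ^ (?a - card (fst p)) * ?y ^ (?b - card (snd p)))
      = (\<Sum>k\<le>Suc ?a. ?x ^ k * ((of_nat ((card (fst p) - 1) choose k) * ?y ^ (?a - card (fst p)))
        * (of_nat ((card (snd p) - 1) choose k) * ?y ^ (?b - card (snd p)))))"
      unfolding simplex_prod_g_sum[OF \<open>card (fst p) \<le> Suc ?a\<close>] sum_distrib_right
      by (intro sum.cong refl) (simp only: mult_ac)
  qed
  also have "\<dots> = (\<Sum>k\<le>Suc ?a. ?x ^ k * ((\<Sum>I\<in>Pow A - {{}}. of_nat ((card I - 1) choose k) * ?y ^ (?a - card I))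
        * (\<Sum>J\<in>Pow B - {{}}. of_nat ((card J - 1) choose k) * ?y ^ (?b - card J))))"
    by (subst sum.swap, rule sum.cong[OF refl], unfold sum_product sum.cartesian_product case_prod_unfold)
      (simp only: sum_distrib_left)
  also have "\<dots> = (\<Sum>k\<le>Suc ?a. ?x ^ k * nonempty_sum ?y k ?a * nonempty_sum ?y k ?b)"
    by (simp only: sum_nonempty_choose less.prems mult.assoc)
  also have "?y ^ (?a + ?b - 1) + \<dots> = ?x ^ ?a * choose_sum ?x (Suc ?a) (?a - 1) (?b - 1)"
  proof -
    have a: "Suc (?a - 1) = ?a" "Suc (?b - 1) = ?b" "?a - 1 + (?b - 1) + 1 = ?a + ?b - 1" using pos by auto
    have "?a - 1 \<le> Suc ?a" by simp
    from sum_nonempty_sum_prod[OF this, of ?x "?b - 1"] show ?thesis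
      unfolding a xy by (simp only: add.commute)
  qed
  also have "\<dots> = ?y * simplex_prod_f ?a ?b + simplex_prod_g ?a ?b"
    using simplex_prod_f_eq[OF pos, of "Suc ?a"] by simp
  finally have "?y * toric_f ?L = ?y * simplex_prod_f ?a ?b" by (simp only: add_right_cancel)
  then have f: "toric_f ?L = simplex_prod_f ?a ?b" unfolding mult_cancel_left by simp
  moreover have "toric_g ?L = simplex_prod_g ?a ?b"
    using g_truncation_simplex_prod_f[OF pos] fin card rank f
    by (simp add: toric_g.simps numeral_2_eq_2)
  ultimately show ?case ..
qed

text \<open>In g + x f, degree i has coefficient c_i + S_min(i - 1, a + b - 1 - i), for 1 <= i <= a
  + b - 1. Up to b - 1, c_i completes S_(i-1) to S_i. From b on c_i is 0, and S stays at S_(b-1)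
  until the mirrored half begins at degree a.\<close>

lemma toric_f_pyramid_simplex_prod:
  assumes "finite A" "finite B" "card B \<le> card A" "B \<noteq> {}"
  shows "toric_f (simplex_prod A B \<times> (UNIV :: bool set)) =
      (\<Sum>k=0..card B - 1. monom (S_coeff (card A) (card B) k) k)
      + smult (S_coeff (card A) (card B) (card B - 1)) (\<Sum>k=card B..card A - 1. monom 1 k)
      + (\<Sum>k=card A..card A + card B - 1. monom (S_coeff (card A) (card B) (card A + card B - 1 - k)) k)"
    (is "_ = ?R")
proof -
  let ?a = "card A" and ?b = "card B"
  have b: "1 \<le> ?b" using assms by (simp add: Suc_le_eq card_gt_0_iff)
  then have a: "1 \<le> ?a" using assms by simp
  then have A: "A \<noteq> {}" by auto
  have "({}, {}) \<in> simplex_prod A B" "(A, B) \<in> simplex_prod A B"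
    using assms A by (auto simp: simplex_prod_def)
  then have "card (simplex_prod A B) \<noteq> 1" using A by (auto simp: card_1_singleton_iff)
  then have f: "toric_f (simplex_prod A B \<times> (UNIV :: bool set))
    = simplex_prod_g ?a ?b + [:0, 1:] * simplex_prod_f ?a ?b"
    using toric_pyramid[OF finite_simplex_prod[OF assms(1,2)] is_top_simplex_prod[OF A assms(4)]]
      toric_simplex_prod[OF assms(1,2) A assms(4)] by simp
  show ?thesis unfolding f
  proof (rule poly_eqI)
    fix i
    have S_mid: "S_coeff ?a ?b l = S_coeff ?a ?b (?b - 1)" if "?b - 1 \<le> l" for l
      using that by (rule S_coeff_const)
    have c0: "hook_coeff ?a ?b k = 0" if "?b \<le> k" for k
      using that b by (simp add: hook_coeff_def binomial_eq_0)
    have R: "coeff ?R i = (if i \<le> ?b - 1 then S_coeff ?a ?b i else 0)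
        + (if ?b \<le> i \<and> i \<le> ?a - 1 then S_coeff ?a ?b (?b - 1) else 0)
        + (if ?a \<le> i \<and> i \<le> ?a + ?b - 1 then S_coeff ?a ?b (?a + ?b - 1 - i) else 0)"
      by (simp add: coeff_sum_monom)
    have L: "coeff (simplex_prod_g ?a ?b + [:0, 1:] * simplex_prod_f ?a ?b) i
      = hook_coeff ?a ?b i + (case i of 0 \<Rightarrow> 0 | Suc j \<Rightarrow> if j \<le> ?a + ?b - 2 then S_coeff ?a ?b (min j (?a + ?b - 2 - j)) else 0)"
      by (cases i) (simp_all add: coeff_simplex_prod_g coeff_simplex_prod_f)
    show "coeff (simplex_prod_g ?a ?b + [:0, 1:] * simplex_prod_f ?a ?b) i = coeff ?R i"
    proof (cases i)
      case 0
      then show ?thesis unfolding R L using a b by (simp add: S_coeff_0 hook_coeff_def)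
    next
      case (Suc j)
      consider "i \<le> ?b - 1" | "?b \<le> i" "i \<le> ?a - 1" | "?a \<le> i" "i \<le> ?a + ?b - 1" | "?a + ?b - 1 < i"
        using a b by linarith
      then show ?thesis
      proof cases
        case 1
        then have "min j (?a + ?b - 2 - j) = j" "j \<le> ?a + ?b - 2" "\<not> ?b \<le> i" "\<not> ?a \<le> i"
          using Suc assms(3) a b by linarith+
        then show ?thesis unfolding R L using 1 Suc by (simp add: S_coeff_Suc)
      next
        case 2
        then have "?b - 1 \<le> min j (?a + ?b - 2 - j)" "j \<le> ?a + ?b - 2" "\<not> i \<le> ?b - 1" "\<not> ?a \<le> i"
          using Suc assms(3) a b by linarith+
        then show ?thesis unfolding R L using 2 Suc S_mid[of "min j (?a + ?b - 2 - j)"] c0[of i] by simp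
      next
        case 3
        then have "min j (?a + ?b - 2 - j) = ?a + ?b - 1 - i" "j \<le> ?a + ?b - 2" "\<not> i \<le> ?b - 1" "\<not> i \<le> ?a - 1" "?b \<le> i"
          using Suc assms(3) a b by linarith+
        then show ?thesis unfolding R L using 3 Suc c0 by simp
      next
        case 4
        then have "\<not> j \<le> ?a + ?b - 2" "\<not> i \<le> ?b - 1" "\<not> i \<le> ?a - 1" "?b \<le> i"
          using Suc assms(3) a b by linarith+
        then show ?thesis unfolding R L using 4 Suc c0 by simp
      qed
    qed
  qed
qed

section \<open>Faces of the hook polytope\<close>

text \<open>This recovers a face from the finitely many generating points on it, so that faces can
  be handled as subsets of \<open>V\<close>.\<close>

lemma face_of_hull_eq_hull_vertices:
  fixes V :: "'a::euclidean_space set"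
  assumes "finite V" "F face_of convex hull V"
  shows "F = convex hull (F \<inter> V)"
proof
  obtain S where S: "S \<subseteq> V" "F = convex hull S"
    using face_of_convex_hull_subset[OF finite_imp_compact[OF assms(1)] assms(2)] by metis
  then have "S \<subseteq> F \<inter> V" using hull_subset[of S convex] by auto
  then show "F \<subseteq> convex hull (F \<inter> V)" using S hull_mono by metis
  show "convex hull (F \<inter> V) \<subseteq> F"
    using face_of_imp_convex[OF assms(2)] by (intro hull_minimal) auto
qed

text \<open>The three conditions make p -> \<open>convex hull (W p)\<close> an order isomorphism
  from \<open>K\<close> onto the face lattice; intersecting with \<open>V\<close> inverts the hull,
  which also reflects the order.\<close>

lemma toric_f_face_lattice:
  fixes V :: "'a::euclidean_space set" and K :: "'k::order set"
  assumes "finite V" "finite K"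
    and order: "\<And>p q. p \<in> K \<Longrightarrow> q \<in> K \<Longrightarrow> W p \<subseteq> W q \<longleftrightarrow> p \<le> q"
    and face: "\<And>p. p \<in> K \<Longrightarrow> \<exists>F. F face_of convex hull V \<and> F \<inter> V = W p"
    and covered: "\<And>F. F face_of convex hull V \<Longrightarrow> \<exists>p\<in>K. F \<inter> V = W p"
  shows "toric_f (face_lattice (convex hull V)) = toric_f K"
proof -
  have hull: "convex hull (W p) face_of convex hull V" "convex hull (W p) \<inter> V = W p" if p: "p \<in> K" for p
  proof -
    obtain F where F: "F face_of convex hull V" "F \<inter> V = W p" using face[OF p] by blast
    then have "F = convex hull (W p)" using face_of_hull_eq_hull_vertices[OF assms(1) F(1)] by simp
    then show "convex hull (W p) face_of convex hull V" "convex hull (W p) \<inter> V = W p" using F by auto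
  qed
  have "face_lattice (convex hull V) = (\<lambda>p. convex hull (W p)) ` K"
  proof
    show "(\<lambda>p. convex hull (W p)) ` K \<subseteq> face_lattice (convex hull V)"
      using hull by (auto simp: face_lattice_def)
    show "face_lattice (convex hull V) \<subseteq> (\<lambda>p. convex hull (W p)) ` K"
    proof
      fix F assume "F \<in> face_lattice (convex hull V)"
      then have F: "F face_of convex hull V" by (simp add: face_lattice_def)
      then obtain p where "p \<in> K" "F \<inter> V = W p" using covered by blast
      then show "F \<in> (\<lambda>p. convex hull (W p)) ` K"
        using face_of_hull_eq_hull_vertices[OF assms(1) F] by auto
    qed
  qed
  moreover have "convex hull (W p) \<subseteq> convex hull (W q) \<longleftrightarrow> p \<le> q" if "p \<in> K" "q \<in> K" for p q
  proof -
    have "W p \<subseteq> W q" if "convex hull (W p) \<subseteq> convex hull (W q)"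
      using that hull(2)[OF \<open>p \<in> K\<close>] hull(2)[OF \<open>q \<in> K\<close>] by blast
    then have "convex hull (W p) \<subseteq> convex hull (W q) \<longleftrightarrow> W p \<subseteq> W q" by (auto intro: hull_mono[THEN subsetD])
    then show ?thesis using order that by blast
  qed
  ultimately show ?thesis
    using toric_iso[OF assms(2), of "\<lambda>p. convex hull (W p)"] by simp
qed

section \<open>Vertices of the hook polytope and the faces they span\<close>

definition hook_apex :: "(nat \<Rightarrow> 'a::real_vector) \<Rightarrow> nat \<Rightarrow> nat \<Rightarrow> 'a" where
  "hook_apex e a b = (\<Sum>l=1..b. e (a + l))"

definition hook_vertex :: "(nat \<Rightarrow> 'a::real_vector) \<Rightarrow> nat \<Rightarrow> nat \<Rightarrow> nat \<Rightarrow> nat \<Rightarrow> 'a" where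
  "hook_vertex e a b i j = hook_apex e a b + e i - e (a + j)"

definition hook_face_vertices ::
  "(nat \<Rightarrow> 'a::real_vector) \<Rightarrow> nat \<Rightarrow> nat \<Rightarrow> (nat set \<times> nat set) \<times> bool \<Rightarrow> 'a set" where
  "hook_face_vertices e a b = (\<lambda>((I, J), c).
    (if c then {hook_apex e a b} else {}) \<union> (\<lambda>(i, j). hook_vertex e a b i j) ` (I \<times> J))"

text \<open>The segments from \<open>v_ij\<close> to \<open>v_kl\<close> and from \<open>v_il\<close> to \<open>v_kj\<close> have the same midpoint.\<close>
lemma hook_vertex_exchange:
  fixes e :: "nat \<Rightarrow> 'a::euclidean_space"
  assumes F: "F face_of S"
    and "hook_vertex e a b i j \<in> F" "hook_vertex e a b k l \<in> F"
    and "hook_vertex e a b i l \<in> S" "hook_vertex e a b k j \<in> S"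
  shows "hook_vertex e a b i l \<in> F"
proof -
  let ?v = "hook_vertex e a b"
  let ?m = "midpoint (?v i j) (?v k l)"
  have m: "?m = midpoint (?v i l) (?v k j)"
    by (simp add: hook_vertex_def midpoint_def algebra_simps)
  have "?m \<in> F"
    using closed_segment_subset[OF assms(2,3) face_of_imp_convex[OF F]] by auto
  \<comment> \<open>If the two other vertices coincide, their open segment is empty, but the
    midpoint is the vertex itself.\<close>
  show ?thesis
  proof (cases "?v i l = ?v k j")
    case True
    then show ?thesis using m \<open>?m \<in> F\<close> by simp
  next
    case False
    then have "?m \<in> open_segment (?v i l) (?v k j)" unfolding m by simp
    then show ?thesis using F \<open>?m \<in> F\<close> assms(4,5) unfolding face_of_def by blast
  qed
qed

context
  fixes a b :: nat and e :: "nat \<Rightarrow> 'a::euclidean_space"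
  assumes basis: "bij_betw e {1..a + b} Basis"
begin

lemma inner_basis: "m \<in> {1..a + b} \<Longrightarrow> n \<in> {1..a + b} \<Longrightarrow> e m \<bullet> e n = (if m = n then 1 else 0)"
  using basis by (metis bij_betw_apply bij_betw_imp_inj_on inj_onD inner_Basis)

lemma inner_sum_basis:
  assumes "M \<subseteq> {1..a + b}" "n \<in> {1..a + b}"
  shows "(\<Sum>m\<in>M. e m) \<bullet> e n = (if n \<in> M then 1 else 0)"
proof -
  have "(\<Sum>m\<in>M. e m) \<bullet> e n = (\<Sum>m\<in>M. if m = n then 1 else 0)"
    unfolding inner_sum_left using assms by (intro sum.cong) (auto simp: inner_basis)
  then show ?thesis using finite_subset[OF assms(1)] by simp
qed

lemma hook_apex_eq: "hook_apex e a b = (\<Sum>m\<in>{a + 1..a + b}. e m)"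
  unfolding hook_apex_def by (rule sum.reindex_bij_witness[of _ "\<lambda>m. m - a" "\<lambda>l. a + l"]) auto

lemma hook_apex_inner: "n \<in> {1..a + b} \<Longrightarrow> hook_apex e a b \<bullet> e n = (if a < n then 1 else 0)"
  unfolding hook_apex_eq by (subst inner_sum_basis) auto

lemma hook_vertex_inner:
  assumes "i \<in> {1..a}" "j \<in> {1..b}" "n \<in> {1..a + b}"
  shows "hook_vertex e a b i j \<bullet> e n = (if n = i \<or> a < n \<and> n \<noteq> a + j then 1 else 0)"
  using assms
  by (auto simp: hook_vertex_def inner_add_left inner_diff_left hook_apex_inner inner_basis)

abbreviation "hook_lattice \<equiv> simplex_prod {1..a} {1..b} \<times> (UNIV :: bool set)"

abbreviation "hook_vertices \<equiv> hook_face_vertices e a b (({1..a}, {1..b}), True)"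

lemma mem_hook_vertices:
  "v \<in> hook_vertices \<longleftrightarrow> v = hook_apex e a b \<or> (\<exists>i\<in>{1..a}. \<exists>j\<in>{1..b}. v = hook_vertex e a b i j)"
  by (auto simp: hook_face_vertices_def)

lemma hook_face_vertices_order:
  assumes "p \<in> hook_lattice" "q \<in> hook_lattice"
  shows "hook_face_vertices e a b p \<subseteq> hook_face_vertices e a b q \<longleftrightarrow> p \<le> q"
proof -
  obtain I J c I' J' c' where pq: "p = ((I, J), c)" "q = ((I', J'), c')"
    by (metis surj_pair)
  have IJ: "I \<subseteq> {1..a}" "J \<subseteq> {1..b}" "I = {} \<longleftrightarrow> J = {}" "I' \<subseteq> {1..a}" "J' \<subseteq> {1..b}" "I' = {} \<longleftrightarrow> J' = {}"
    using assms by (auto simp: pq simplex_prod_def)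
  have ne: "hook_vertex e a b i j \<noteq> hook_apex e a b" if "i \<in> {1..a}" "j \<in> {1..b}" for i j
    using that hook_vertex_inner[of i j i] hook_apex_inner[of i] by auto
  \<comment> \<open>Coordinate \<open>i\<close> of \<open>v_ij\<close> is 1 and coordinate
    \<open>a + j\<close> is 0; among the vertices \<open>v_kl\<close> the first forces k = i and the
    second l = j.\<close>
  have eq: "i = k \<and> j = l" if "hook_vertex e a b i j = hook_vertex e a b k l"
    "i \<in> {1..a}" "j \<in> {1..b}" "k \<in> {1..a}" "l \<in> {1..b}" for i j k l
  proof -
    have "i \<in> {1..a + b}" "a + j \<in> {1..a + b}" using that by auto
    then show ?thesis
      using that(1) hook_vertex_inner[OF that(2,3), of i] hook_vertex_inner[OF that(4,5), of i]
        hook_vertex_inner[OF that(2,3), of "a + j"] hook_vertex_inner[OF that(4,5), of "a + j"] that(2-5)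
      by (simp split: if_splits)
  qed
  have apex: "hook_apex e a b \<in> hook_face_vertices e a b ((A, B), d) \<longleftrightarrow> d"
    if "A \<subseteq> {1..a}" "B \<subseteq> {1..b}" for A B d
  proof -
    have "hook_apex e a b \<notin> (\<lambda>(i, j). hook_vertex e a b i j) ` (A \<times> B)"
    proof
      assume "hook_apex e a b \<in> (\<lambda>(i, j). hook_vertex e a b i j) ` (A \<times> B)"
      then obtain i j where "i \<in> A" "j \<in> B" "hook_apex e a b = hook_vertex e a b i j" by auto
      then show False using ne[of i j] that by (metis subsetD)
    qed
    then show ?thesis by (simp add: hook_face_vertices_def)
  qed
  have vertex: "hook_vertex e a b i j \<in> hook_face_vertices e a b ((A, B), d) \<longleftrightarrow> i \<in> A \<and> j \<in> B"
    if AB: "A \<subseteq> {1..a}" "B \<subseteq> {1..b}" and ij: "i \<in> {1..a}" "j \<in> {1..b}" for A B d i j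
  proof
    assume "hook_vertex e a b i j \<in> hook_face_vertices e a b ((A, B), d)"
    then obtain k l where "k \<in> A" "l \<in> B" "hook_vertex e a b i j = hook_vertex e a b k l"
      using ne[OF ij] by (auto simp: hook_face_vertices_def split: if_splits)
    moreover from this have "k \<in> {1..a}" "l \<in> {1..b}" using AB by blast+
    ultimately show "i \<in> A \<and> j \<in> B" using eq ij by blast
  qed (auto simp: hook_face_vertices_def)
  show ?thesis
  proof
    assume sub: "hook_face_vertices e a b p \<subseteq> hook_face_vertices e a b q"
    have "c \<le> c'"
      using sub apex[OF IJ(1,2), of c] apex[OF IJ(4,5), of c'] unfolding pq by auto
    moreover have *: "i \<in> I' \<and> j \<in> J'" if "i \<in> I" "j \<in> J" for i j
    proof -
      have "i \<in> {1..a}" "j \<in> {1..b}" using that IJ by blast+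
      then show ?thesis
        using sub vertex[OF IJ(1,2), of i j c] vertex[OF IJ(4,5), of i j c'] that unfolding pq by blast
    qed
    \<comment> \<open>Since \<open>I\<close> and \<open>J\<close> are empty together, each index of
      one occurs in some pair with an index of the other.\<close>
    moreover have "I \<subseteq> I'" "J \<subseteq> J'" using * IJ(3) by blast+
    ultimately show "p \<le> q" by (simp add: pq)
  next
    assume "p \<le> q"
    then show "hook_face_vertices e a b p \<subseteq> hook_face_vertices e a b q"
      by (auto simp: pq hook_face_vertices_def split: if_splits)
  qed
qed

lemma hook_face_vertices_exposed:
  assumes "p \<in> hook_lattice"
  shows "\<exists>F. F face_of convex hull hook_vertices \<and> F \<inter> hook_vertices = hook_face_vertices e a b p"
proof -
  obtain I J c where p: "p = ((I, J), c)" by (metis surj_pair)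
  have IJ: "I \<subseteq> {1..a}" "J \<subseteq> {1..b}" using assms by (auto simp: p simplex_prod_def)
  let ?A = "{1..a}" and ?B = "{1..b}"
  \<comment> \<open>The functional \<open>u\<close> minus \<open>d\<close> counts violations: at
    \<open>v_ij\<close> one for \<open>i\<close> outside \<open>I\<close> and one for
    \<open>j\<close> outside \<open>J\<close>. If the apex is to be excluded, the last term of
    \<open>u\<close> and the shift in \<open>d\<close> raise its value from 0 to 1. Hence the
    hyperplane at level \<open>d\<close> is supporting and meets exactly the chosen
    vertices.\<close>
  define u where "u = (\<Sum>m\<in>?A - I. e m) - (\<Sum>m\<in>(+) a ` (?B - J). e m) - (if c then 0 else \<Sum>m\<in>?A. e m)"
  define d where "d = u \<bullet> hook_apex e a b - (if c then 0 else 1)"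
  have ue1: "u \<bullet> e i = (if i \<in> I then 0 else 1) - (if c then 0 else 1)" if "i \<in> ?A" for i
  proof -
    have "i \<in> {1..a + b}" "i \<notin> (+) a ` (?B - J)" using that by auto
    moreover have "?A - I \<subseteq> {1..a + b}" "(+) a ` (?B - J) \<subseteq> {1..a + b}" "?A \<subseteq> {1..a + b}" by auto
    ultimately show ?thesis using that
      by (simp add: u_def inner_diff_left inner_sum_basis)
  qed
  have ue2: "u \<bullet> e (a + j) = (if j \<in> J then 0 else - 1)" if "j \<in> ?B" for j
  proof -
    have "a + j \<in> {1..a + b}" "a + j \<notin> ?A" using that by auto
    moreover have "?A - I \<subseteq> {1..a + b}" "(+) a ` (?B - J) \<subseteq> {1..a + b}" "?A \<subseteq> {1..a + b}" by auto
    moreover have "a + j \<in> (+) a ` (?B - J) \<longleftrightarrow> j \<notin> J" using that by auto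
    ultimately show ?thesis using that
      by (simp add: u_def inner_diff_left inner_sum_basis)
  qed
  have apex: "u \<bullet> hook_apex e a b - d = (if c then 0 else 1)" by (simp add: d_def)
  have vertex: "u \<bullet> hook_vertex e a b i j - d = (if i \<in> I then 0 else 1) + (if j \<in> J then 0 else 1)"
    if "i \<in> ?A" "j \<in> ?B" for i j
    using that by (simp add: hook_vertex_def inner_add_right inner_diff_right ue1 ue2 d_def)
  have nonneg: "u \<bullet> v \<ge> d" if "v \<in> hook_vertices" for v
  proof -
    from that consider "v = hook_apex e a b" | i j where "v = hook_vertex e a b i j" "i \<in> ?A" "j \<in> ?B"
      using mem_hook_vertices by blast
    then show ?thesis
    proof cases
      case 1
      then show ?thesis using apex by (auto split: if_splits)
    next
      case 2
      then show ?thesis using vertex[of i j] by (auto split: if_splits)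
    qed
  qed
  then have "convex hull hook_vertices \<subseteq> {x. u \<bullet> x \<ge> d}"
    by (intro hull_minimal) (auto simp: convex_halfspace_ge)
  then have "(convex hull hook_vertices \<inter> {x. u \<bullet> x = d}) face_of convex hull hook_vertices"
    by (intro face_of_Int_supporting_hyperplane_ge) auto
  moreover have "(convex hull hook_vertices \<inter> {x. u \<bullet> x = d}) \<inter> hook_vertices = hook_face_vertices e a b p"
  proof -
    have "(convex hull hook_vertices \<inter> {x. u \<bullet> x = d}) \<inter> hook_vertices = {v \<in> hook_vertices. u \<bullet> v = d}"
      using hull_subset by fastforce
    also have "\<dots> = hook_face_vertices e a b p"
    proof (intro equalityI subsetI)
      fix v assume v: "v \<in> {v \<in> hook_vertices. u \<bullet> v = d}"
      then consider "v = hook_apex e a b" | i j where "v = hook_vertex e a b i j" "i \<in> ?A" "j \<in> ?B"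
        using mem_hook_vertices by blast
      then show "v \<in> hook_face_vertices e a b p"
      proof cases
        case 1
        then show ?thesis using v apex by (auto simp: p hook_face_vertices_def split: if_splits)
      next
        case 2
        then show ?thesis using v vertex[of i j] by (auto simp: p hook_face_vertices_def split: if_splits)
      qed
    next
      fix v assume "v \<in> hook_face_vertices e a b p"
      then consider "v = hook_apex e a b" c | i j where "v = hook_vertex e a b i j" "i \<in> I" "j \<in> J"
        by (auto simp: p hook_face_vertices_def split: if_splits)
      then show "v \<in> {v \<in> hook_vertices. u \<bullet> v = d}"
      proof cases
        case 1
        then show ?thesis using apex by (auto simp: hook_face_vertices_def)
      next
        case 2
        then have "i \<in> ?A" "j \<in> ?B" using IJ by blast+
        then show ?thesis using 2 vertex[of i j] by (auto simp: hook_face_vertices_def)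
      qed
    qed
    finally show ?thesis .
  qed
  ultimately show ?thesis by blast
qed

text \<open>Let \<open>I\<close> and \<open>J\<close> be the projections of the set of pairs (i, j)
  with \<open>v_ij\<close> on the face. By \<open>hook_vertex_exchange\<close> that set is all of
  \<open>I \<times> J\<close>, and the projections are empty together.\<close>

lemma hook_face_vertices_cover:
  assumes F: "F face_of convex hull hook_vertices"
  shows "\<exists>p\<in>hook_lattice. F \<inter> hook_vertices = hook_face_vertices e a b p"
proof -
  let ?A = "{1..a}" and ?B = "{1..b}" and ?v = "hook_vertex e a b"
  define I where "I = {i \<in> ?A. \<exists>j\<in>?B. ?v i j \<in> F}"
  define J where "J = {j \<in> ?B. \<exists>i\<in>?A. ?v i j \<in> F}"
  define c where "c = (hook_apex e a b \<in> F)"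
  have inV: "?v i j \<in> hook_vertices" if "i \<in> ?A" "j \<in> ?B" for i j
    using that by (auto simp: hook_face_vertices_def)
  then have inS: "?v i j \<in> convex hull hook_vertices" if "i \<in> ?A" "j \<in> ?B" for i j
    using that by (intro hull_inc)
  have IJ: "?v i l \<in> F" if "i \<in> I" "l \<in> J" for i l
  proof -
    from that obtain j k where "j \<in> ?B" "?v i j \<in> F" "k \<in> ?A" "?v k l \<in> F" "i \<in> ?A" "l \<in> ?B"
      unfolding I_def J_def by blast
    then show ?thesis using hook_vertex_exchange[OF F, of e a b i j k l] inS by blast
  qed
  have "F \<inter> hook_vertices = hook_face_vertices e a b ((I, J), c)"
  proof (intro equalityI subsetI)
    fix x assume "x \<in> F \<inter> hook_vertices"
    then show "x \<in> hook_face_vertices e a b ((I, J), c)"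
      by (auto simp: hook_face_vertices_def I_def J_def c_def)
  next
    fix x assume "x \<in> hook_face_vertices e a b ((I, J), c)"
    then consider "x = hook_apex e a b" c | i j where "x = ?v i j" "i \<in> I" "j \<in> J"
      by (auto simp: hook_face_vertices_def split: if_splits)
    then show "x \<in> F \<inter> hook_vertices"
    proof cases
      case 1
      then show ?thesis by (auto simp: hook_face_vertices_def c_def)
    next
      case 2
      moreover from this have "i \<in> ?A" "j \<in> ?B" by (auto simp: I_def J_def)
      ultimately show ?thesis using IJ inV by blast
    qed
  qed
  moreover have "((I, J), c) \<in> hook_lattice"
    by (auto simp: simplex_prod_def I_def J_def)
  ultimately show ?thesis by blast
qed

lemma toric_f_hook_lattice: "toric_f (face_lattice (convex hull hook_vertices)) = toric_f hook_lattice"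
proof (rule toric_f_face_lattice)
  show "finite hook_vertices" by (simp add: hook_face_vertices_def)
  show "finite hook_lattice" by (simp add: finite_simplex_prod)
qed (rule hook_face_vertices_order hook_face_vertices_exposed hook_face_vertices_cover, assumption+)+

end

section \<open>Hook lattice paths\<close>

lemma height_Suc: "height s (Suc k) = height s k + (if Suc k \<in> north_positions s then 1 else 0)"
proof (cases "k < length s")
  case True
  then show ?thesis
    by (simp add: height_def north_positions_def take_Suc_conv_app_nth)
qed (simp add: height_def north_positions_def)

text \<open>It turns the conditions on a path into counting conditions on its set of north
  steps.\<close>

lemma height_eq_card: "height s k = card (north_positions s \<inter> {1..k})"
proof (induction k)
  case (Suc k)
  have "north_positions s \<inter> {1..Suc k}
    = (if Suc k \<in> north_positions s then insert (Suc k) (north_positions s \<inter> {1..k}) else north_positions s \<inter> {1..k})"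
    by (auto simp: le_Suc_eq)
  then show ?case by (simp add: height_Suc Suc)
qed (simp add: height_def)

lemma count_list_replicate: "count_list (replicate n x) y = (if x = y then n else 0)"
  by (induction n) auto

lemma height_lower_path: "height (lower_path a b) k = min (k - a) b"
  by (simp add: height_def lower_path_def count_list_replicate)

lemma height_upper_path:
  assumes "1 \<le> a"
  shows "height (upper_path a b) k = (if k = 0 then 0 else 1 + min (k - a) (b - 1))"
proof (cases k)
  case (Suc j)
  have "take m [East] = [] \<or> take m [East] = [East]" for m by (cases m) auto
  then have E: "count_list (take m [East]) North = 0" for m
    by (metis count_list.simps step.distinct(1))
  show ?thesis using Suc assms
    by (simp add: height_def upper_path_def count_list_replicate E)
qed (simp add: height_def)

lemma length_steps: "length s = count_list s East + count_list s North"
proof (induction s)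
  case (Cons x s)
  then show ?case by (cases x) auto
qed simp

lemma north_positions_hook_path:
  assumes "s \<in> hook_paths a b" "1 \<le> a" "1 \<le> b"
  shows "north_positions s = {a + 1..a + b} \<or>
    (\<exists>i\<in>{1..a}. \<exists>j\<in>{1..b}. north_positions s = insert i ({a + 1..a + b} - {a + j}))"
proof -
  let ?N = "north_positions s"
  define X Y where "X = ?N \<inter> {1..a}" and "Y = ?N \<inter> {a + 1..a + b}"
  have len: "length s = a + b" using assms by (simp add: hook_paths_def length_steps)
  then have N: "?N \<subseteq> {1..a + b}" by (auto simp: north_positions_def)
  have "{1..a} \<union> {a + 1..a + b} = {1..a + b}" by auto
  then have NXY: "?N = X \<union> Y" using N unfolding X_def Y_def by blast
  have "height s (a + b) = b" using assms len by (simp add: hook_paths_def height_def)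
  moreover have "?N \<inter> {1..a + b} = ?N" using N by blast
  ultimately have "card ?N = b" by (simp add: height_eq_card)
  moreover have fin: "finite X" "finite Y" by (simp_all add: X_def Y_def)
  moreover have "X \<inter> Y = {}" by (auto simp: X_def Y_def)
  ultimately have card: "card X + card Y = b" using NXY card_Un_disjoint by metis
  \<comment> \<open>The upper boundary at time \<open>a\<close> permits at most one early north
    step; with \<open>b\<close> north steps in total, the last \<open>b\<close> positions then miss
    as many as came early.\<close>
  have "height s a \<le> height (upper_path a b) a" using assms by (simp add: hook_paths_def)
  also have "\<dots> = 1" using assms by (simp add: height_upper_path)
  finally have "card X \<le> 1" by (simp add: height_eq_card X_def)
  then consider "card X = 0" | "card X = 1" by linarith
  then show ?thesis
  proof cases
    case 1
    then have "Y = {a + 1..a + b}" using card by (intro card_subset_eq) (auto simp: Y_def)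
    then show ?thesis using 1 fin NXY by simp
  next
    case 2
    then obtain i where i: "X = {i}" by (auto simp: card_1_singleton_iff)
    have Y: "Y \<subseteq> {a + 1..a + b}" by (auto simp: Y_def)
    then have "card ({a + 1..a + b} - Y) = 1"
      using card 2 fin assms by (subst card_Diff_subset) auto
    then obtain m where m: "{a + 1..a + b} - Y = {m}" by (auto simp: card_1_singleton_iff)
    then have "m \<in> {a + 1..a + b}" by blast
    then obtain j where j: "m = a + j" "j \<in> {1..b}"
      by (metis add_le_cancel_left atLeastAtMost_iff le_add1 le_trans nat_le_iff_add)
    have "Y = {a + 1..a + b} - {a + j}" using m Y j by blast
    moreover have "i \<in> {1..a}" using i by (auto simp: X_def)
    moreover have "?N = insert i Y" using NXY i by simp
    ultimately show ?thesis using j(2) by blast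
  qed
qed

section \<open>Existence of hook paths with given north steps\<close>

definition path_of :: "nat \<Rightarrow> nat set \<Rightarrow> step list" where
  "path_of n N = map (\<lambda>i. if i \<in> N then North else East) [1..<Suc n]"

lemma north_positions_path_of:
  assumes "N \<subseteq> {1..n}"
  shows "north_positions (path_of n N) = N"
proof -
  have "path_of n N ! (i - 1) = (if i \<in> N then North else East)" if "1 \<le> i" "i \<le> n" for i
    using that by (simp add: path_of_def del: upt_Suc)
  moreover have "length (path_of n N) = n" by (simp add: path_of_def del: upt_Suc)
  ultimately show ?thesis using assms by (auto simp: north_positions_def split: if_splits)
qed

text \<open>The last two conditions are the boundary heights at time \<open>k\<close>; for k <= a +
  b the lower height \<open>min (k - a) b\<close> is just \<open>k - a\<close>.\<close>

lemma path_of_in_hook_paths: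
  assumes "1 \<le> a" "N \<subseteq> {1..a + b}" "card N = b"
    and "\<And>k. k \<le> a + b \<Longrightarrow> k - a \<le> card (N \<inter> {1..k})"
    and "\<And>k. 1 \<le> k \<Longrightarrow> k \<le> a + b \<Longrightarrow> card (N \<inter> {1..k}) \<le> 1 + min (k - a) (b - 1)"
  shows "path_of (a + b) N \<in> hook_paths a b"
proof -
  let ?s = "path_of (a + b) N"
  have len: "length ?s = a + b" by (simp add: path_of_def del: upt_Suc)
  have h: "height ?s k = card (N \<inter> {1..k})" for k
    using assms(2) by (simp add: height_eq_card north_positions_path_of)
  have "N \<inter> {1..a + b} = N" using assms(2) by blast
  then have "count_list ?s North = b" using h[of "a + b"] len assms(3) by (simp add: height_def)
  then show ?thesis
    using length_steps[of ?s] len assms(1,4,5) h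
    by (auto simp: hook_paths_def height_lower_path height_upper_path)
qed

lemma hook_path_exists_apex:
  assumes "1 \<le> a" "1 \<le> b"
  shows "path_of (a + b) {a + 1..a + b} \<in> hook_paths a b"
proof (rule path_of_in_hook_paths)
  have *: "{a + 1..a + b} \<inter> {1..k} = {a + 1..k}" if "k \<le> a + b" for k using that by auto
  show "k - a \<le> card ({a + 1..a + b} \<inter> {1..k})" if "k \<le> a + b" for k
    unfolding *[OF that] by simp
  show "card ({a + 1..a + b} \<inter> {1..k}) \<le> 1 + min (k - a) (b - 1)" if "k \<le> a + b" for k
    unfolding *[OF that] using that assms by auto
qed (use assms in auto)

lemma hook_path_exists_vertex:
  assumes "1 \<le> a" "i \<in> {1..a}" "j \<in> {1..b}"
  shows "path_of (a + b) (insert i ({a + 1..a + b} - {a + j})) \<in> hook_paths a b"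
proof (rule path_of_in_hook_paths)
  let ?N = "insert i ({a + 1..a + b} - {a + j})"
  have c: "card (?N \<inter> {1..k}) = (if i \<le> k then 1 else 0) + (if a + j \<le> k then k - a - 1 else k - a)"
    if "k \<le> a + b" for k
  proof -
    have "?N \<inter> {1..k} = (if i \<le> k then {i} else {}) \<union> ({a + 1..k} - {a + j})"
      using that assms by auto
    also have "card \<dots> = card (if i \<le> k then {i} else {}) + card ({a + 1..k} - {a + j})"
      using assms by (intro card_Un_disjoint) auto
    also have "card ({a + 1..k} - {a + j}) = (if a + j \<le> k then k - a - 1 else k - a)"
      using assms by auto
    finally show ?thesis by simp
  qed
  \<comment> \<open>Once the missing position \<open>a + j\<close> is passed, the early north step
    at i <= a has compensated for it.\<close>
  show "k - a \<le> card (?N \<inter> {1..k})" if "k \<le> a + b" for k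
    unfolding c[OF that] using assms by auto
  show "card (?N \<inter> {1..k}) \<le> 1 + min (k - a) (b - 1)" if "k \<le> a + b" for k
    unfolding c[OF that] using that assms by auto
  show "card ?N = b" using assms by simp
  show "?N \<subseteq> {1..a + b}" using assms by auto
qed (use assms in simp)

lemma north_positions_hook_paths:
  assumes "1 \<le> a" "1 \<le> b"
  shows "north_positions ` hook_paths a b =
    insert {a + 1..a + b} ((\<lambda>(i, j). insert i ({a + 1..a + b} - {a + j})) ` ({1..a} \<times> {1..b}))"
    (is "_ = ?R")
proof
  show "north_positions ` hook_paths a b \<subseteq> ?R"
    using north_positions_hook_path[OF _ assms] by fastforce
  have "{a + 1..a + b} \<in> north_positions ` hook_paths a b"
    using hook_path_exists_apex[OF assms] north_positions_path_of[of "{a + 1..a + b}" "a + b"]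
    by (intro image_eqI[of _ _ "path_of (a + b) {a + 1..a + b}"]) auto
  moreover have "insert i ({a + 1..a + b} - {a + j}) \<in> north_positions ` hook_paths a b"
    if "i \<in> {1..a}" "j \<in> {1..b}" for i j
  proof (rule image_eqI)
    show "path_of (a + b) (insert i ({a + 1..a + b} - {a + j})) \<in> hook_paths a b"
      using hook_path_exists_vertex assms(1) that by blast
    show "insert i ({a + 1..a + b} - {a + j})
      = north_positions (path_of (a + b) (insert i ({a + 1..a + b} - {a + j})))"
      using that by (intro north_positions_path_of[symmetric]) auto
  qed
  ultimately show "?R \<subseteq> north_positions ` hook_paths a b" by auto
qed

lemma hook_polytope_eq:
  assumes "1 \<le> a" "1 \<le> b"
  shows "hook_polytope e a b = convex hull hook_face_vertices e a b (({1..a}, {1..b}), True)"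
proof -
  have apex: "(\<Sum>i\<in>{a + 1..a + b}. e i) = hook_apex e a b"
    unfolding hook_apex_def by (rule sum.reindex_bij_witness[of _ "\<lambda>l. a + l" "\<lambda>m. m - a"]) auto
  have vertex: "(\<Sum>m\<in>insert i ({a + 1..a + b} - {a + j}). e m) = hook_vertex e a b i j"
    if "i \<in> {1..a}" "j \<in> {1..b}" for i j
  proof -
    have "(\<Sum>m\<in>insert i ({a + 1..a + b} - {a + j}). e m) = e i + (\<Sum>m\<in>{a + 1..a + b} - {a + j}. e m)"
      using that by (intro sum.insert) auto
    also have "(\<Sum>m\<in>{a + 1..a + b} - {a + j}. e m) = hook_apex e a b - e (a + j)"
      using that unfolding apex[symmetric] by (subst sum_diff1) auto
    finally show ?thesis by (simp add: hook_vertex_def)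
  qed
  have "(\<lambda>s. \<Sum>i\<in>north_positions s. e i) ` hook_paths a b
    = (\<lambda>N. \<Sum>i\<in>N. e i) ` north_positions ` hook_paths a b" by (simp add: image_image)
  also have "\<dots> = insert (hook_apex e a b)
      ((\<lambda>p. \<Sum>m\<in>(case p of (i, j) \<Rightarrow> insert i ({a + 1..a + b} - {a + j})). e m) ` ({1..a} \<times> {1..b}))"
    unfolding north_positions_hook_paths[OF assms] image_insert apex image_image ..
  also have "((\<lambda>p. \<Sum>m\<in>(case p of (i, j) \<Rightarrow> insert i ({a + 1..a + b} - {a + j})). e m) ` ({1..a} \<times> {1..b}))
     = (\<lambda>(i, j). hook_vertex e a b i j) ` ({1..a} \<times> {1..b})"
    by (rule image_cong[OF refl]) (use vertex in auto)
  finally show ?thesis by (simp add: hook_polytope_def hook_face_vertices_def)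
qed

theorem corollary1:
  fixes \<alpha> \<beta> :: nat and e :: "nat \<Rightarrow> 'a::euclidean_space"
  assumes "1 \<le> \<beta>" and "\<beta> \<le> \<alpha>"
    and "bij_betw e {1..\<alpha> + \<beta>} Basis"
  shows "toric_f (face_lattice (hook_polytope e \<alpha> \<beta>)) =
      (\<Sum>k=0..\<beta> - 1. monom (S_coeff \<alpha> \<beta> k) k)
      + smult (S_coeff \<alpha> \<beta> (\<beta> - 1)) (\<Sum>k=\<beta>..\<alpha> - 1. monom 1 k)
      + (\<Sum>k=\<alpha>..\<alpha> + \<beta> - 1. monom (S_coeff \<alpha> \<beta> (\<alpha> + \<beta> - 1 - k)) k)"
proof -
  have "1 \<le> \<alpha>" using assms by simp
  then show ?thesis
    using hook_polytope_eq[of \<alpha> \<beta> e] toric_f_hook_lattice[OF assms(3)]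
      toric_f_pyramid_simplex_prod[of "{1..\<alpha>}" "{1..\<beta>}"] assms(1,2)
    by simp
qed

end
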